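(* (a) Let $\Gamma$ be a triangulation of a connected closed surface $M$ with a fixed $z$-orientation $\tau$ such that every face of $\Gamma$ is of type I and every zigzag in $\tau$ is homogeneous. Let $\Gamma_{II}$ be the subgraph of $\Gamma$ formed by all vertices of type II and all edges of type II (directed as type II edges). Then $\Gamma_{II}$ is a closed $2$-cell embedding in $M$ of a connected simple Eulerian digraph (every vertex has in-degree equal to out-degree) in which the boundary of every face is a directed cycle, and $\Gamma=\mathrm{T}(\Gamma_{II})$. (b) Conversely, let $\Gamma'$ be a closed $2$-cell embedding in $M$ of a connected simple Eulerian digraph such that the boundary of every face is a directed cycle. Then the triangulation $\mathrm{T}(\Gamma')$ admits a unique $z$-orientation for which all faces are of type I, all zigzags are homogeneous, and $\Gamma'$ (with its directions) is exactly the subgraph of $\mathrm{T}(\Gamma')$ formed by all vertices and edges of type II (with their type II directions).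
   Context: Let $M$ be a connected closed $2$-dimensional surface (not necessarily orientable). A triangulation of $M$ is a $2$-cell embedding of a connected simple finite graph in $M$ such that every face is a triangle. A zigzag in a triangulation $\Gamma$ is a sequence of edges $(e_i)_{i\in\mathbb N}$ such that for every $i$: $e_i$ and $e_{i+1}$ are distinct edges of a common face; the face containing $e_i,e_{i+1}$ is different from the face containing $e_{i+1},e_{i+2}$; and $e_i$, $e_{i+2}$ have no common vertex. It is regarded as a cyclic sequence $e_1,\dots,e_n$ ($n$ the minimal period), and passes through each of its edges in a definite direction (from the vertex shared with the previous edge to the vertex shared with the next). The reversal $Z^{-1}$ of a zigzag is a zigzag, $Z\ne Z^{-1}$. If $\Gamma$ has exactly $k$ zigzags up to reversal, a $z$-orientation is a set $\tau$ of $k$ zigzags containing exactly one of $Z,Z^{-1}$ for each zigzag $Z$. For a $z$-orientation, each edge either occurs twice in one zigzag of $\tau$ or once in each of two distinct zigzags of $\tau$ (and in no others); it is of type I if these two passages are in opposite directions and of type II if in the same direction (type II edges are directed accordingly). A vertex is of type I if all edges containing it are of type I, otherwise of type II. A face is of type I if it contains exactly two edges of type I and one edge of type II. When all faces are of type I, a zigzag is homogeneous if it is a cyclic sequence $e_1,e_1',e_1'',e_2,e_2',e_2'',\dots,e_n,e_n',e_n''$ in which every $e_i$ is of type II and every $e_i',e_i''$ is of type I. A $2$-cell embedding is closed if every face is homeomorphic to a closed $2$-disc. For a closed $2$-cell embedding $\Gamma'$ of a connected simple finite graph in $M$, $\mathrm{T}(\Gamma')$ denotes the triangulation of $M$ obtained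 by choosing a point $v_F$ in the interior of every face $F$, adding all $v_F$ as vertices, and joining each $v_F$ by an edge (inside $F$) to every vertex of $F$. *)

theory Defs
  imports Main
begin

text \<open>Combinatorial model. A triangulation of a connected closed surface whose graph is
simple is encoded as a finite simplicial surface: a vertex set V and a set T of 3-element
vertex sets (the faces), every edge lying in exactly two faces, every vertex link a single
cycle, and the graph connected.\<close>

definition edges_of :: "'v set set \<Rightarrow> 'v set set" where
  "edges_of T = {e. card e = 2 \<and> (\<exists>t\<in>T. e \<subseteq> t)}"

definition triangulation :: "'v set \<Rightarrow> 'v set set \<Rightarrow> bool" where
  "triangulation V T \<longleftrightarrow>
     finite V \<and> V \<noteq> {} \<and> (\<forall>t\<in>T. t \<subseteq> V \<and> card t = 3) \<and>
     (\<forall>e\<in>edges_of T. card {t\<in>T. e \<subseteq> t} = 2) \<and>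
     (\<forall>v\<in>V. (\<exists>u. {v,u} \<in> edges_of T) \<and>
        (\<forall>u w. {v,u} \<in> edges_of T \<longrightarrow> {v,w} \<in> edges_of T \<longrightarrow>
           (u,w) \<in> {(x,y). x \<noteq> y \<and> v \<notin> {x,y} \<and> {v,x,y} \<in> T}\<^sup>*)) \<and>
     (\<forall>u\<in>V. \<forall>w\<in>V. (u,w) \<in> {(x,y). {x,y} \<in> edges_of T}\<^sup>*)"

text \<open>Zigzags (as sequences indexed by nat, as in the paper).\<close>

definition is_zigzag :: "'v set set \<Rightarrow> (nat \<Rightarrow> 'v set) \<Rightarrow> bool" where
  "is_zigzag T z \<longleftrightarrow>
     (\<forall>i. z i \<in> edges_of T \<and> z i \<noteq> z (Suc i) \<and> z i \<union> z (Suc i) \<in> T \<and>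
          z i \<union> z (Suc i) \<noteq> z (Suc i) \<union> z (Suc (Suc i)) \<and>
          z i \<inter> z (Suc (Suc i)) = {})"

text \<open>A zigzag regarded as a cyclic sequence: the class of all its shifts.\<close>

definition shift_class :: "(nat \<Rightarrow> 'a) \<Rightarrow> (nat \<Rightarrow> 'a) set" where
  "shift_class z = {(\<lambda>i. z (i + k)) | k. True}"

definition zigzags :: "'v set set \<Rightarrow> (nat \<Rightarrow> 'v set) set set" where
  "zigzags T = {shift_class z | z. is_zigzag T z}"

definition zz_reverse :: "(nat \<Rightarrow> 'a) set \<Rightarrow> (nat \<Rightarrow> 'a) set" where
  "zz_reverse Z = {(\<lambda>i. z (p - i mod p)) | z p. z \<in> Z \<and> p > 0 \<and> (\<forall>i. z (i + p) = z i)}"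

definition z_orientation :: "'v set set \<Rightarrow> (nat \<Rightarrow> 'v set) set set \<Rightarrow> bool" where
  "z_orientation T \<tau> \<longleftrightarrow>
     \<tau> \<subseteq> zigzags T \<and> (\<forall>Z\<in>zigzags T. Z \<in> \<tau> \<longleftrightarrow> zz_reverse Z \<notin> \<tau>)"

text \<open>Directions (tail, head) in which the zigzags of tau pass through the edge e:
the tail is the vertex shared with the previous edge, the head the vertex shared with
the next edge.\<close>

definition zz_dirs :: "(nat \<Rightarrow> 'v set) set set \<Rightarrow> 'v set \<Rightarrow> ('v \<times> 'v) set" where
  "zz_dirs \<tau> e = {(a,b). \<exists>Z\<in>\<tau>. \<exists>z\<in>Z. \<exists>i. z (Suc i) = e \<and> a \<in> z i \<inter> e \<and> b \<in> z (Suc (Suc i)) \<inter> e}"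

definition edge_typeI :: "(nat \<Rightarrow> 'v set) set set \<Rightarrow> 'v set \<Rightarrow> bool" where
  "edge_typeI \<tau> e \<longleftrightarrow> (\<exists>a b. a \<noteq> b \<and> zz_dirs \<tau> e = {(a,b),(b,a)})"

definition edge_typeII :: "(nat \<Rightarrow> 'v set) set set \<Rightarrow> 'v set \<Rightarrow> bool" where
  "edge_typeII \<tau> e \<longleftrightarrow> (\<exists>a b. zz_dirs \<tau> e = {(a,b)})"

text \<open>Type II edges directed accordingly.\<close>
definition typeII_arcs :: "'v set set \<Rightarrow> (nat \<Rightarrow> 'v set) set set \<Rightarrow> ('v \<times> 'v) set" where
  "typeII_arcs T \<tau> = {(a,b). {a,b} \<in> edges_of T \<and> zz_dirs \<tau> {a,b} = {(a,b)}}"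

text \<open>A vertex is of type II iff it is not of type I, i.e. some edge containing it is not of type I.\<close>
definition typeII_vertices :: "'v set \<Rightarrow> 'v set set \<Rightarrow> (nat \<Rightarrow> 'v set) set set \<Rightarrow> 'v set" where
  "typeII_vertices V T \<tau> = {v\<in>V. \<exists>e\<in>edges_of T. v \<in> e \<and> \<not> edge_typeI \<tau> e}"

definition face_typeI :: "'v set set \<Rightarrow> (nat \<Rightarrow> 'v set) set set \<Rightarrow> 'v set \<Rightarrow> bool" where
  "face_typeI T \<tau> t \<longleftrightarrow>
     card {e\<in>edges_of T. e \<subseteq> t \<and> edge_typeI \<tau> e} = 2 \<and>
     card {e\<in>edges_of T. e \<subseteq> t \<and> edge_typeII \<tau> e} = 1"

definition homogeneous :: "(nat \<Rightarrow> 'v set) set set \<Rightarrow> (nat \<Rightarrow> 'v set) set \<Rightarrow> bool" where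
  "homogeneous \<tau> Z \<longleftrightarrow>
     (\<exists>z\<in>Z. \<forall>i. edge_typeII \<tau> (z (3*i)) \<and> edge_typeI \<tau> (z (3*i+1)) \<and> edge_typeI \<tau> (z (3*i+2)))"

text \<open>Closed 2-cell embeddings of connected simple graphs, encoded as polygonal surfaces:
abstract faces Fs, each with boundary cycle bd F (a cyclic list of distinct vertices).\<close>

definition cyc_adj :: "'v list \<Rightarrow> 'v \<Rightarrow> 'v \<Rightarrow> bool" where
  "cyc_adj l a b \<longleftrightarrow> (\<exists>i<length l. l ! i = a \<and> l ! (Suc i mod length l) = b)"

definition face_edges :: "'v list \<Rightarrow> 'v set set" where
  "face_edges l = {{a,b} | a b. cyc_adj l a b}"

definition closed_2cell_embedding ::
  "'v set \<Rightarrow> 'v set set \<Rightarrow> 'f set \<Rightarrow> ('f \<Rightarrow> 'v list) \<Rightarrow> bool" where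
  "closed_2cell_embedding V E Fs bd \<longleftrightarrow>
     finite V \<and> V \<noteq> {} \<and> finite Fs \<and>
     (\<forall>e\<in>E. card e = 2 \<and> e \<subseteq> V) \<and>
     (\<forall>F\<in>Fs. distinct (bd F) \<and> length (bd F) \<ge> 3 \<and> face_edges (bd F) \<subseteq> E) \<and>
     (\<forall>e\<in>E. card {F\<in>Fs. e \<in> face_edges (bd F)} = 2) \<and>
     (\<forall>v\<in>V. (\<exists>u. {v,u} \<in> E) \<and>
        (\<forall>u w. {v,u} \<in> E \<longrightarrow> {v,w} \<in> E \<longrightarrow>
          (u,w) \<in> {(x,y). \<exists>F\<in>Fs. (cyc_adj (bd F) x v \<and> cyc_adj (bd F) v y) \<or>
                                   (cyc_adj (bd F) y v \<and> cyc_adj (bd F) v x)}\<^sup>*)) \<and>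
     (\<forall>u\<in>V. \<forall>w\<in>V. (u,w) \<in> {(x,y). {x,y} \<in> E}\<^sup>*)"

definition underlying :: "('v \<times> 'v) set \<Rightarrow> 'v set set" where
  "underlying A = {{a,b} | a b. (a,b) \<in> A}"

definition simple_digraph :: "'v set \<Rightarrow> ('v \<times> 'v) set \<Rightarrow> bool" where
  "simple_digraph V A \<longleftrightarrow> A \<subseteq> V \<times> V \<and> (\<forall>(a,b)\<in>A. a \<noteq> b \<and> (b,a) \<notin> A)"

definition eulerian :: "'v set \<Rightarrow> ('v \<times> 'v) set \<Rightarrow> bool" where
  "eulerian V A \<longleftrightarrow> (\<forall>v\<in>V. card {u. (u,v) \<in> A} = card {w. (v,w) \<in> A})"

definition directed_faces :: "('v \<times> 'v) set \<Rightarrow> 'f set \<Rightarrow> ('f \<Rightarrow> 'v list) \<Rightarrow> bool" where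
  "directed_faces A Fs bd \<longleftrightarrow>
     (\<forall>F\<in>Fs. (\<forall>a b. cyc_adj (bd F) a b \<longrightarrow> (a,b) \<in> A) \<or>
             (\<forall>a b. cyc_adj (bd F) a b \<longrightarrow> (b,a) \<in> A))"

text \<open>Closed 2-cell embedding of a connected simple Eulerian digraph in which every face
boundary is a directed cycle.\<close>
definition eulerian_dir_embedding ::
  "'v set \<Rightarrow> ('v \<times> 'v) set \<Rightarrow> 'f set \<Rightarrow> ('f \<Rightarrow> 'v list) \<Rightarrow> bool" where
  "eulerian_dir_embedding V A Fs bd \<longleftrightarrow>
     simple_digraph V A \<and> closed_2cell_embedding V (underlying A) Fs bd \<and>
     eulerian V A \<and> directed_faces A Fs bd"

text \<open>The triangulation T(Gamma'): a new vertex Inr F for each face F joined to the vertices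
of F.\<close>
definition T_verts :: "'v set \<Rightarrow> 'f set \<Rightarrow> ('v + 'f) set" where
  "T_verts V Fs = Inl ` V \<union> Inr ` Fs"

definition T_tris :: "'f set \<Rightarrow> ('f \<Rightarrow> 'v list) \<Rightarrow> ('v + 'f) set set" where
  "T_tris Fs bd = {{Inr F, Inl a, Inl b} | F a b. F \<in> Fs \<and> cyc_adj (bd F) a b}"

end

theory Submission
  imports Defs
begin

text \<open>
A zigzag is determined by a \<^emph>\<open>flag\<close> \<open>(x, y, z)\<close>, the first three vertices it visits. Passing to the next
flag is a permutation of the finite set of flags, conjugated to its inverse by the reversal
\<open>(x, y, z) \<mapsto> (z, y, x)\<close>. Hence a z-orientation is the same thing as a set \<open>S\<close> of flags that is invariant
under this permutation and contains exactly one of each flag and its reversal. The type of an edge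
\<open>{x, y}\<close> can be read off from either face \<open>{x, y, w}\<close> at it: the edge is directed from \<open>x\<close> to \<open>y\<close> if both
\<open>(x, y, w)\<close> and \<open>(w, x, y)\<close> lie in \<open>S\<close>, and it is of type I if exactly one of them does.

If a face \<open>{a, b, c}\<close> has type II arc \<open>a \<rightarrow> b\<close>, homogeneity of the zigzag through \<open>(a, b, c)\<close> shows that
the adjacent face \<open>{b, c, d}\<close> at the edge \<open>{b, c}\<close> has type II arc \<open>b \<rightarrow> d\<close>. So the link of \<open>c\<close> is a directed
cycle and \<open>c\<close> is the centre of a face of the type II subgraph. Conversely, in the triangulation
obtained from a directed embedding, the flags in which the tail of the arc of the face precedes its
head form the only possible \<open>S\<close>.
\<close>

section \<open>Permutations and cyclic lists\<close>

lemma funpow_cancel: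
  assumes maps: "\<And>x. x \<in> N \<Longrightarrow> s x \<in> N" and inj: "inj_on s N" and x: "x \<in> N"
    and eq: "(s ^^ i) x = (s ^^ (i + k)) x"
  shows "(s ^^ k) x = x"
proof -
  have "(s ^^ i) x \<in> N" for i
    by (induction i) (auto simp: x maps)
  then show ?thesis
    using eq by (induction i) (auto dest!: inj_onD[OF inj])
qed

text \<open>By pigeonhole two iterates of \<open>x\<close> coincide, and injectivity cancels the
  common initial steps, so the first repeated point is \<open>x\<close> itself.\<close>

lemma funpow_returns:
  assumes fin: "finite N" and maps: "\<And>x. x \<in> N \<Longrightarrow> s x \<in> N" and inj: "inj_on s N" and x: "x \<in> N"
  shows "\<exists>n>0. (s ^^ n) x = x"
proof -
  have "(s ^^ i) x \<in> N" for i
    by (induction i) (auto simp: x maps)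
  then have "range (\<lambda>i. (s ^^ i) x) \<subseteq> N"
    by blast
  then have "finite (range (\<lambda>i. (s ^^ i) x))"
    using fin by (rule finite_subset)
  then have "\<not> inj (\<lambda>i. (s ^^ i) x)"
    using finite_imageD by blast
  then obtain i j where "i < j" "(s ^^ i) x = (s ^^ j) x"
    unfolding inj_def by (metis linorder_neqE_nat)
  then show ?thesis
    using funpow_cancel[OF maps inj x, of i "j - i"] by (intro exI[of _ "j - i"]) auto
qed

section \<open>Cyclic adjacency in a list\<close>

lemma cyc_adj_fun:
  assumes "distinct l" "cyc_adj l a b" "cyc_adj l a c"
  shows "b = c"
  using assms unfolding cyc_adj_def by (auto simp: nth_eq_iff_index_eq)

lemma cyc_adj_inj:
  assumes l: "distinct l" and ab: "cyc_adj l a c" "cyc_adj l b c"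
  shows "a = b"
proof -
  obtain i where i: "i < length l" "l ! i = a" "l ! (Suc i mod length l) = c"
    using ab(1) unfolding cyc_adj_def by blast
  obtain j where j: "j < length l" "l ! j = b" "l ! (Suc j mod length l) = c"
    using ab(2) unfolding cyc_adj_def by blast
  have "Suc i mod length l = Suc j mod length l"
    using l i j by (metis gr_implies_not0 length_greater_0_conv list.size(3) mod_less_divisor nth_eq_iff_index_eq)
  then have "i = j" using i(1) j(1) by (auto simp: mod_Suc split: if_splits)
  then show ?thesis using i j by simp
qed

lemma cyc_adj_in_set: "cyc_adj l a b \<Longrightarrow> a \<in> set l \<and> b \<in> set l"
  unfolding cyc_adj_def by (metis gr_implies_not0 length_greater_0_conv list.size(3) mod_less_divisor nth_mem)

lemma cyc_adj_succ:
  assumes "a \<in> set l"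
  obtains b where "cyc_adj l a b"
  using assms unfolding cyc_adj_def by (auto simp: in_set_conv_nth)

lemma cyc_adj_pred:
  assumes "b \<in> set l"
  obtains a where "cyc_adj l a b"
proof -
  obtain i where i: "i < length l" "l ! i = b" using assms by (auto simp: in_set_conv_nth)
  define j where "j = (if i = 0 then length l - 1 else i - 1)"
  have "j < length l" "Suc j mod length l = i"
    using i(1) by (auto simp: j_def)
  then have "cyc_adj l (l ! j) b" using i unfolding cyc_adj_def by auto
  then show ?thesis using that by blast
qed

lemma cyc_adj_connected:
  assumes "a \<in> set l" "b \<in> set l"
  shows "(a, b) \<in> {(x, y). cyc_adj l x y}\<^sup>*"
proof -
  let ?R = "{(x, y). cyc_adj l x y}"
  have steps: "(l ! i, l ! ((i + k) mod length l)) \<in> ?R\<^sup>*" if "i < length l" for i k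
  proof (induction k)
    case 0
    then show ?case using that by simp
  next
    case (Suc k)
    have "(l ! ((i + k) mod length l), l ! ((i + Suc k) mod length l)) \<in> ?R"
      using that unfolding cyc_adj_def
      by (auto simp: mod_Suc_eq intro!: exI[of _ "(i + k) mod length l"] mod_less_divisor)
    with Suc show ?case by (rule rtrancl_into_rtrancl)
  qed
  obtain i j where ij: "i < length l" "l ! i = a" "j < length l" "l ! j = b"
    using assms by (metis in_set_conv_nth)
  \<comment> \<open>Going forward past the end of the list and then on to index \<open>j\<close>
    works whether or not \<open>i\<close> is smaller than \<open>j\<close>.\<close>
  have "(i + (length l - i + j)) mod length l = j" using ij by simp
  then show ?thesis using steps[OF ij(1), of "length l - i + j"] ij by simp
qed

text \<open>An injective self-map of a finite set splits it into cycles, and these are the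
  components of the relation in \<open>conn\<close>; connectedness leaves a single cycle, which is
  listed from an arbitrary point. This turns the link of a vertex into the boundary list of a
  face.\<close>

lemma cyc_list_of_permutation:
  assumes fin: "finite N" and ne: "N \<noteq> {}" and maps: "\<And>x. x \<in> N \<Longrightarrow> s x \<in> N"
    and inj: "inj_on s N"
    and conn: "\<And>u w. u \<in> N \<Longrightarrow> w \<in> N \<Longrightarrow> (u, w) \<in> {(x, y). x \<in> N \<and> y \<in> N \<and> (y = s x \<or> x = s y)}\<^sup>*"
  shows "\<exists>l. distinct l \<and> set l = N \<and> (\<forall>a b. cyc_adj l a b \<longleftrightarrow> a \<in> N \<and> b = s a)"
proof -
  obtain x where x: "x \<in> N" using ne by blast
  \<comment> \<open>Minimality of the period makes the \<open>n\<close> listed iterates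
    distinct.\<close>
  define n where "n = (LEAST n. n > 0 \<and> (s ^^ n) x = x)"
  have n: "n > 0" "(s ^^ n) x = x"
    using LeastI_ex[OF funpow_returns[OF fin maps inj x]] unfolding n_def by auto
  have least: "(s ^^ m) x \<noteq> x" if "0 < m" "m < n" for m
    using not_less_Least[of m "\<lambda>n. n > 0 \<and> (s ^^ n) x = x"] that unfolding n_def by auto
  have inN: "(s ^^ i) x \<in> N" for i
    by (induction i) (auto simp: x maps)
  define l where "l = map (\<lambda>i. (s ^^ i) x) [0..<n]"
  have len: "length l = n" and nth: "\<And>i. i < n \<Longrightarrow> l ! i = (s ^^ i) x"
    unfolding l_def by auto
  have "(s ^^ i) x \<noteq> (s ^^ j) x" if "i < j" "j < n" for i j
  proof
    assume "(s ^^ i) x = (s ^^ j) x"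
    then have "(s ^^ (j - i)) x = x"
      using funpow_cancel[OF maps inj x, of i "j - i"] that by simp
    then show False using least[of "j - i"] that by (simp add: less_imp_diff_less)
  qed
  then have dist: "distinct l"
    unfolding distinct_conv_nth len using nth by (metis linorder_neqE_nat)
  have mod: "(s ^^ (i mod n)) x = (s ^^ i) x" for i
    using n(2) by (rule funpow_mod_eq)
  have set_l: "set l = range (\<lambda>i. (s ^^ i) x)"
  proof (intro equalityI subsetI)
    fix y assume "y \<in> range (\<lambda>i. (s ^^ i) x)"
    then obtain i where "y = (s ^^ (i mod n)) x" unfolding mod by blast
    then show "y \<in> set l" using n(1) unfolding l_def by auto
  qed (auto simp: l_def)
  have closed: "w \<in> set l" if "w \<in> N" for w
    using conn[OF x that]
  proof (induction rule: rtrancl_induct)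
    case base
    show ?case unfolding set_l by (auto intro: image_eqI[of _ _ 0])
  next
    case (step y z)
    then obtain i where i: "y = (s ^^ i) x" unfolding set_l by blast
    from step(2) have z: "z \<in> N" "z = s y \<or> y = s z" by auto
    show ?case
    proof (cases "z = s y")
      case True
      then have "z = (s ^^ Suc i) x" using i by simp
      then show ?thesis unfolding set_l by blast
    next
      case False
      \<comment> \<open>A step backwards is replaced by \<open>n - 1\<close> steps forwards: the
        iterate with exponent \<open>i + n - 1\<close> has the same image as \<open>z\<close>, so it
        is \<open>z\<close>.\<close>
      have "(s ^^ (i + n)) x = (s ^^ i) x" using n(2) by (simp add: funpow_add)
      moreover obtain m where m: "n = Suc m" using n(1) gr0_conv_Suc by blast
      ultimately have "s ((s ^^ (i + m)) x) = s z" using i z(2) False by simp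
      then have "z = (s ^^ (i + m)) x" by (rule inj_onD[OF inj _ inN z(1), symmetric])
      then show ?thesis unfolding set_l by blast
    qed
  qed
  have setN: "set l = N"
    using closed inN unfolding set_l by blast
  have "cyc_adj l a b \<longleftrightarrow> a \<in> N \<and> b = s a" for a b
  proof -
    have "cyc_adj l a b \<longleftrightarrow> (\<exists>i<n. (s ^^ i) x = a \<and> (s ^^ (Suc i mod n)) x = b)"
      unfolding cyc_adj_def len using nth n(1) by auto
    also have "\<dots> \<longleftrightarrow> (\<exists>i<n. (s ^^ i) x = a) \<and> b = s a"
      unfolding mod by auto
    also have "(\<exists>i<n. (s ^^ i) x = a) \<longleftrightarrow> a \<in> set l"
      unfolding l_def by auto
    finally show ?thesis using setN by simp
  qed
  then show ?thesis using dist setN by blast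
qed

lemma underlying_iff: "{a, b} \<in> underlying A \<longleftrightarrow> (a, b) \<in> A \<or> (b, a) \<in> A"
  unfolding underlying_def by (auto simp: doubleton_eq_iff)

lemma underlyingE:
  assumes "e \<in> underlying A"
  obtains a b where "e = {a, b}" "(a, b) \<in> A"
  using assms unfolding underlying_def by blast

lemma face_edges_iff: "{a, b} \<in> face_edges l \<longleftrightarrow> cyc_adj l a b \<or> cyc_adj l b a"
  unfolding face_edges_def by (auto simp: doubleton_eq_iff)

section \<open>Flags and zigzags\<close>

text \<open>The local conditions on edges and faces on which the calculus of flags rests. It is
  instantiated both by the given triangulation and by \<open>T_tris\<close>.\<close>

locale closed_pseudosurface =
  fixes T :: "'v set set"
  assumes finite_T: "finite T"
    and card_face: "t \<in> T \<Longrightarrow> card t = 3"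
    and edge_in_two_faces: "e \<in> edges_of T \<Longrightarrow> card {t \<in> T. e \<subseteq> t} = 2"
begin

definition flags :: "('v \<times> 'v \<times> 'v) set" where
  "flags = {(x, y, z). {x, y, z} \<in> T}"

text \<open>The third vertex of the face on the other side of the edge \<open>{x, y}\<close> from
  the face \<open>{x, y, z}\<close>; it is well defined by \<open>opp_ex1\<close>.\<close>

definition opp :: "'v \<Rightarrow> 'v \<Rightarrow> 'v \<Rightarrow> 'v" where
  "opp x y z = (THE w. w \<noteq> z \<and> {x, y, w} \<in> T)"

text \<open>One step of the zigzag as a walk on vertices: after \<open>x\<close>, \<open>y\<close>,
  \<open>z\<close> it crosses the edge \<open>{y, z}\<close> into the next face and continues to the
  new vertex of that face.\<close>

fun nxt :: "'v \<times> 'v \<times> 'v \<Rightarrow> 'v \<times> 'v \<times> 'v" where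
  "nxt (x, y, z) = (y, z, opp y z x)"

fun rev_flag :: "'v \<times> 'v \<times> 'v \<Rightarrow> 'v \<times> 'v \<times> 'v" where
  "rev_flag (x, y, z) = (z, y, x)"

fun flag_edge :: "'v \<times> 'v \<times> 'v \<Rightarrow> 'v set" where
  "flag_edge (x, y, z) = {x, y}"

definition zz :: "'v \<times> 'v \<times> 'v \<Rightarrow> nat \<Rightarrow> 'v set" where
  "zz f = (\<lambda>i. flag_edge ((nxt ^^ i) f))"

definition zz_class :: "'v \<times> 'v \<times> 'v \<Rightarrow> (nat \<Rightarrow> 'v set) set" where
  "zz_class f = shift_class (zz f)"

section \<open>The two faces at an edge\<close>

lemma face_distinct:
  assumes "{x, y, z} \<in> T"
  shows "x \<noteq> y" "y \<noteq> z" "x \<noteq> z"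
  using card_face[OF assms] by (auto simp: card_insert_if split: if_splits)

lemma face_edges_of:
  assumes "{x, y, z} \<in> T"
  shows "{x, y} \<in> edges_of T" "{y, z} \<in> edges_of T" "{x, z} \<in> edges_of T"
  using face_distinct[OF assms] unfolding edges_of_def
  by (auto intro!: bexI[OF _ assms])

lemma edges_ofE:
  assumes "{x, y} \<in> edges_of T"
  obtains z where "{x, y, z} \<in> T"
proof -
  from assms obtain t where t: "t \<in> T" "{x, y} \<subseteq> t" and c: "card {x, y} = 2"
    unfolding edges_of_def by auto
  have "card (t - {x, y}) = 1"
    using t c card_face[OF t(1)] by (subst card_Diff_subset) auto
  then obtain z where "t - {x, y} = {z}" by (rule card_1_singletonE)
  then have "t = {x, y, z}" using t by auto
  then show ?thesis using t that by blast
qed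

text \<open>The edge \<open>{x, y}\<close> lies in exactly two faces, and each of them is determined
  by its third vertex; one of these vertices is \<open>z\<close>.\<close>

lemma opp_ex1:
  assumes T: "{x, y, z} \<in> T"
  shows "\<exists>!w. w \<noteq> z \<and> {x, y, w} \<in> T"
proof -
  note d = face_distinct[OF T]
  have "card {t \<in> T. {x, y} \<subseteq> t} = 2"
    using edge_in_two_faces face_edges_of[OF T] by blast
  then obtain s t where st: "{t \<in> T. {x, y} \<subseteq> t} = {s, t}" "s \<noteq> t"
    by (auto simp: card_2_iff)
  have third: "\<exists>w. u = {x, y, w}" if "u \<in> T" "{x, y} \<subseteq> u" for u
  proof -
    have "card (u - {x, y}) = 1"
      using that d card_face[OF that(1)] by (subst card_Diff_subset) auto
    then obtain w where "u - {x, y} = {w}" by (rule card_1_singletonE)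
    then show ?thesis using that by (intro exI[of _ w]) auto
  qed
  have "{x, y, z} \<in> {t \<in> T. {x, y} \<subseteq> t}" using T by simp
  then have "{x, y, z} = s \<or> {x, y, z} = t" unfolding st(1) by simp
  then obtain u where u: "{t \<in> T. {x, y} \<subseteq> t} = {{x, y, z}, u}" "u \<noteq> {x, y, z}"
  proof (elim disjE)
    assume "{x, y, z} = s"
    then show thesis using that[of t] st by simp
  next
    assume "{x, y, z} = t"
    then show thesis using that[of s] st by (simp add: insert_commute[of s t])
  qed
  have "u \<in> {t \<in> T. {x, y} \<subseteq> t}" unfolding u(1) by simp
  then have "u \<in> T" "{x, y} \<subseteq> u" by simp_all
  then obtain w where w: "u = {x, y, w}" using third by blast
  show ?thesis
  proof (rule ex1I[of _ w])
    show "w \<noteq> z \<and> {x, y, w} \<in> T" using u w by auto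
  next
    fix v assume v: "v \<noteq> z \<and> {x, y, v} \<in> T"
    then have "{x, y, v} \<in> {t \<in> T. {x, y} \<subseteq> t}" by simp
    then have "v \<in> {x, y, z} \<or> v \<in> {x, y, w}" unfolding u(1) w by auto
    then show "v = w" using v face_distinct[of x y v] by simp
  qed
qed

lemma opp_in:
  assumes "{x, y, z} \<in> T"
  shows "opp x y z \<noteq> z" "{x, y, opp x y z} \<in> T"
  using theI'[OF opp_ex1[OF assms]] unfolding opp_def by auto

lemma opp_eq:
  assumes "{x, y, z} \<in> T" "w \<noteq> z" "{x, y, w} \<in> T"
  shows "opp x y z = w"
  using the1_equality[OF opp_ex1[OF assms(1)]] assms unfolding opp_def by auto

lemma opp_opp: "{x, y, z} \<in> T \<Longrightarrow> opp x y (opp x y z) = z"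
  by (rule opp_eq[OF opp_in(2) opp_in(1)[symmetric]])

lemma opp_swap: "opp x y z = opp y x z"
  unfolding opp_def by (subst insert_commute) (rule refl)

section \<open>The permutation of flags and its reversal\<close>

lemma flags_iff [simp]: "(x, y, z) \<in> flags \<longleftrightarrow> {x, y, z} \<in> T"
  unfolding flags_def by simp

lemma finite_flags: "finite flags"
proof -
  have "finite t" if "t \<in> T" for t
    using card_face[OF that] by (simp add: card_ge_0_finite)
  then have "finite (\<Union>T)" using finite_T by blast
  moreover have "flags \<subseteq> \<Union>T \<times> \<Union>T \<times> \<Union>T"
    unfolding flags_def by auto
  ultimately show ?thesis by (meson finite_SigmaI finite_subset)
qed

lemma nxt_flag: "f \<in> flags \<Longrightarrow> nxt f \<in> flags"
proof (cases f)
  case (fields x y z)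
  assume "f \<in> flags"
  then have "{y, z, x} \<in> T" using fields by (simp add: insert_commute)
  from opp_in(2)[OF this] show ?thesis using fields by simp
qed

lemma funpow_nxt_flag: "f \<in> flags \<Longrightarrow> (nxt ^^ k) f \<in> flags"
  by (induction k) (auto intro: nxt_flag)

lemma rev_flag_flag [simp]: "rev_flag f \<in> flags \<longleftrightarrow> f \<in> flags"
  by (cases f) (auto simp: insert_commute)

lemma rev_flag_rev_flag [simp]: "rev_flag (rev_flag f) = f"
  by (cases f) auto

text \<open>Crossing the same edge back returns to the first face, by \<open>opp_opp\<close>. Hence
  reversal conjugates \<open>nxt\<close> to its inverse, which also yields preimages under
  \<open>nxt\<close> and its injectivity.\<close>

lemma nxt_rev_nxt:
  assumes "f \<in> flags"
  shows "nxt (rev_flag (nxt f)) = rev_flag f"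
proof -
  obtain x y z where f: "f = (x, y, z)" by (cases f) auto
  then have "{y, z, x} \<in> T" using assms by (simp add: insert_commute)
  from opp_opp[OF this] show ?thesis using f opp_swap by simp
qed

lemma funpow_nxt_rev:
  assumes "f \<in> flags"
  shows "(nxt ^^ k) (rev_flag ((nxt ^^ k) f)) = rev_flag f"
proof (induction k)
  case (Suc k)
  have "(nxt ^^ Suc k) (rev_flag ((nxt ^^ Suc k) f))
      = (nxt ^^ k) (nxt (rev_flag (nxt ((nxt ^^ k) f))))"
    by (simp add: funpow_swap1)
  then show ?case
    using Suc nxt_rev_nxt[OF funpow_nxt_flag[OF assms]] by simp
qed simp

lemma nxt_surj:
  assumes "f \<in> flags"
  obtains g where "g \<in> flags" "nxt g = f"
proof (rule that)
  show "rev_flag (nxt (rev_flag f)) \<in> flags" using assms nxt_flag by simp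
  show "nxt (rev_flag (nxt (rev_flag f))) = f" using assms nxt_rev_nxt[of "rev_flag f"] by simp
qed

lemma inj_on_nxt: "inj_on nxt flags"
proof (rule inj_on_inverseI)
  show "rev_flag (nxt (rev_flag (nxt f))) = f" if "f \<in> flags" for f
    using that by (simp add: nxt_rev_nxt)
qed

lemma nxt_period: "f \<in> flags \<Longrightarrow> \<exists>n>0. (nxt ^^ n) f = f"
  by (rule funpow_returns[OF finite_flags nxt_flag inj_on_nxt])

text \<open>The edges \<open>{x, y}\<close> and \<open>{y, z}\<close> meet only in \<open>y\<close>,
  so together they determine the order of the three vertices.\<close>

lemma flag_edge_inj:
  assumes "f \<in> flags" "g \<in> flags" "flag_edge f = flag_edge g" "flag_edge (nxt f) = flag_edge (nxt g)"
  shows "f = g"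
proof -
  obtain x y z where f: "f = (x, y, z)" by (cases f) auto
  obtain x' y' z' where g: "g = (x', y', z')" by (cases g) auto
  show ?thesis
    using assms(3,4) face_distinct[of x y z] face_distinct[of x' y' z'] assms(1,2)
    unfolding f g flags_iff by (simp add: doubleton_eq_iff) blast
qed

lemma zz_inj:
  assumes "f \<in> flags" "g \<in> flags" "zz f = zz g"
  shows "f = g"
  using flag_edge_inj[OF assms(1,2)] fun_cong[OF assms(3), of 0] fun_cong[OF assms(3), of 1]
  unfolding zz_def by simp

section \<open>Zigzags as orbits of flags\<close>

lemma zz_shift: "zz f (i + k) = zz ((nxt ^^ k) f) i"
  unfolding zz_def by (simp add: funpow_add)

lemma zz_class_eq: "zz_class f = {zz ((nxt ^^ k) f) | k. True}"
  unfolding zz_class_def shift_class_def zz_shift by simp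

lemma zz_in_zz_class: "zz f \<in> zz_class f"
  unfolding zz_class_eq by (auto intro: exI[of _ 0])

lemma is_zigzag_zz:
  assumes f: "f \<in> flags"
  shows "is_zigzag T (zz f)"
  unfolding is_zigzag_def
proof
  fix i
  obtain x y z where g: "(nxt ^^ i) f = (x, y, z)" by (cases "(nxt ^^ i) f") auto
  then have T: "{x, y, z} \<in> T" using funpow_nxt_flag[OF f, of i] by simp
  then have T': "{y, z, x} \<in> T" by (simp add: insert_commute)
  define w where "w = opp y z x"
  have w: "w \<noteq> x" "{y, z, w} \<in> T" using opp_in[OF T'] unfolding w_def by auto
  have zs: "zz f i = {x, y}" "zz f (Suc i) = {y, z}" "zz f (Suc (Suc i)) = {z, w}"
    unfolding zz_def w_def using g by simp_all
  have "{x, y} \<union> {y, z} = {x, y, z}" "{y, z} \<union> {z, w} = {y, z, w}" by auto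
  then show "zz f i \<in> edges_of T \<and> zz f i \<noteq> zz f (Suc i) \<and> zz f i \<union> zz f (Suc i) \<in> T \<and>
      zz f i \<union> zz f (Suc i) \<noteq> zz f (Suc i) \<union> zz f (Suc (Suc i)) \<and> zz f i \<inter> zz f (Suc (Suc i)) = {}"
    unfolding zs using T w face_distinct[OF T] face_distinct[OF w(2)] face_edges_of[OF T]
    by (auto simp: doubleton_eq_iff)
qed

text \<open>The first two edges give a flag, and the conditions on a zigzag leave no choice
  afterwards: since the edges two apart are disjoint, the walk leaves from the newest vertex, and
  since the faces differ, its next vertex is given by \<open>opp\<close>.\<close>

lemma is_zigzag_imp_zz:
  assumes z: "is_zigzag T z"
  obtains f where "f \<in> flags" "z = zz f"
proof -
  \<comment> \<open>Two distinct edges whose union has three elements share one vertex, which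
    becomes the middle of the flag.\<close>
  have cross: "\<exists>a b c. s = {a, b} \<and> s' = {b, c} \<and> {a, b, c} \<in> T"
    if s: "card s = 2" "card s' = 2" "s \<noteq> s'" "s \<union> s' \<in> T" for s s' :: "'v set"
  proof -
    obtain p q where pq: "s = {p, q}" "p \<noteq> q" using s(1) by (auto simp: card_2_iff)
    obtain u v where uv: "s' = {u, v}" "u \<noteq> v" using s(2) by (auto simp: card_2_iff)
    have "card {p, q, u, v} = 3"
      using card_face[OF s(4)] pq uv by (simp add: insert_commute)
    then have "p = u \<or> p = v \<or> q = u \<or> q = v"
      using pq uv by (auto simp: card_insert_if split: if_splits)
    then obtain a b c where "{p, q} = {a, b}" "{u, v} = {b, c}"
      by (elim disjE) (auto simp: insert_commute)
    moreover from this have "s \<union> s' = {a, b, c}" unfolding pq uv by auto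
    ultimately show ?thesis using s(4) pq(1) uv(1) by (intro exI[of _ a] exI[of _ b] exI[of _ c]) simp
  qed
  have two: "card (z i) = 2" for i using z unfolding is_zigzag_def edges_of_def by auto
  have conss: "\<exists>a b c. z i = {a, b} \<and> z (Suc i) = {b, c} \<and> {a, b, c} \<in> T" for i
    using cross[OF two[of i] two[of "Suc i"]] z unfolding is_zigzag_def by auto
  obtain a b c where abc: "z 0 = {a, b}" "z 1 = {b, c}" "{a, b, c} \<in> T"
    using conss[of 0] by auto
  define f where "f = (a, b, c)"
  have f: "f \<in> flags" using abc unfolding f_def by simp
  \<comment> \<open>The induction carries two consecutive edges, since a single edge does not
    determine the flag.\<close>
  have "z i = flag_edge ((nxt ^^ i) f) \<and> z (Suc i) = flag_edge ((nxt ^^ Suc i) f)" for i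
  proof (induction i)
    case 0
    then show ?case using abc unfolding f_def by simp
  next
    case (Suc i)
    obtain x y u where g: "(nxt ^^ i) f = (x, y, u)" by (cases "(nxt ^^ i) f") auto
    then have T: "{x, y, u} \<in> T" using funpow_nxt_flag[OF f, of i] by simp
    have zi: "z i = {x, y}" "z (Suc i) = {y, u}" using Suc g by auto
    obtain p q w where pqw: "z (Suc i) = {p, q}" "z (Suc (Suc i)) = {q, w}" "{p, q, w} \<in> T"
      using conss[of "Suc i"] by auto
    have "z i \<inter> z (Suc (Suc i)) = {}"
      and ne: "z i \<union> z (Suc i) \<noteq> z (Suc i) \<union> z (Suc (Suc i))"
      using z unfolding is_zigzag_def by blast+
    then have q: "q = u" "p = y"
      using zi pqw by (auto simp: doubleton_eq_iff)
    have "w \<noteq> x" using ne zi pqw q by auto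
    then have "opp y u x = w"
      using T pqw q by (intro opp_eq) (auto simp: insert_commute)
    then show ?case using Suc g pqw q by simp
  qed
  then have "z = zz f" unfolding zz_def by auto
  then show ?thesis using f that by blast
qed

lemma zigzags_eq: "zigzags T = zz_class ` flags"
proof -
  have "{z. is_zigzag T z} = zz ` flags"
    using is_zigzag_zz by (auto elim: is_zigzag_imp_zz)
  moreover have "zigzags T = shift_class ` {z. is_zigzag T z}"
    unfolding zigzags_def by blast
  ultimately show ?thesis
    unfolding zz_class_def by (simp add: image_image)
qed

text \<open>Dropping the first edge loses no shift, because the orbit is periodic:
  \<open>n - 1\<close> further steps lead from \<open>nxt f\<close> back to
  \<open>f\<close>.\<close>

lemma zz_class_nxt:
  assumes "f \<in> flags"
  shows "zz_class (nxt f) = zz_class f"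
proof -
  obtain n where n: "n > 0" "(nxt ^^ n) f = f" using nxt_period[OF assms] by blast
  have bwd: "(nxt ^^ k) f = (nxt ^^ (k + (n - 1))) (nxt f)" for k
  proof -
    have "(nxt ^^ k) f = (nxt ^^ (k + n)) f" using n by (simp add: funpow_add)
    also have "k + n = Suc (k + (n - 1))" using n by simp
    finally show ?thesis
      by (simp only: funpow_Suc_right o_apply)
  qed
  have forth: "(nxt ^^ m) (nxt f) = (nxt ^^ Suc m) f" for m
    by (simp only: funpow_Suc_right o_apply)
  show ?thesis
    unfolding zz_class_eq
  proof (intro equalityI subsetI; elim CollectE exE conjE)
    fix y k assume "y = zz ((nxt ^^ k) (nxt f))"
    then show "y \<in> {zz ((nxt ^^ k) f) |k. True}" unfolding forth by blast
  next
    fix y k assume "y = zz ((nxt ^^ k) f)"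
    then show "y \<in> {zz ((nxt ^^ k) (nxt f)) |k. True}" unfolding bwd[of k] by blast
  qed
qed

lemma zz_class_funpow: "f \<in> flags \<Longrightarrow> zz_class ((nxt ^^ k) f) = zz_class f"
  by (induction k) (auto simp: zz_class_nxt funpow_nxt_flag)

lemma zz_class_eqD:
  assumes "f \<in> flags" "g \<in> flags" "zz_class f = zz_class g"
  obtains k where "f = (nxt ^^ k) g"
proof -
  have "zz f \<in> zz_class g" using zz_in_zz_class assms(3) by blast
  then obtain k where "zz f = zz ((nxt ^^ k) g)" unfolding zz_class_eq by blast
  then show ?thesis using zz_inj[OF assms(1) funpow_nxt_flag[OF assms(2)]] that by blast
qed

text \<open>By \<open>funpow_nxt_rev\<close>, \<open>k\<close> steps from the reversal of the later
  flag lead to the reversal of \<open>f\<close>, so both lie in one orbit.\<close>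

lemma zz_class_rev_funpow:
  assumes "f \<in> flags"
  shows "zz_class (rev_flag ((nxt ^^ k) f)) = zz_class (rev_flag f)"
  using zz_class_funpow[of "rev_flag ((nxt ^^ k) f)" k] funpow_nxt_flag[OF assms] funpow_nxt_rev[OF assms]
  by simp

text \<open>Reading backwards starts at index \<open>p\<close>, which is the edge of
  \<open>g\<close> itself by periodicity. The first edge of \<open>rev_flag g\<close> is instead the
  second edge of \<open>g\<close>; the additional \<open>nxt\<close> corrects this offset.\<close>

lemma zz_reversed:
  assumes g: "g \<in> flags" and p: "p > 0" and per: "(nxt ^^ p) g = g"
  shows "(\<lambda>i. zz g (p - i mod p)) = zz (nxt (rev_flag g))"
proof
  fix i
  define h where "h = (nxt ^^ (p - i mod p)) g"
  have h: "h \<in> flags" unfolding h_def by (rule funpow_nxt_flag[OF g])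
  have "(nxt ^^ (i mod p)) h = (nxt ^^ (i mod p + (p - i mod p))) g"
    unfolding h_def by (simp add: funpow_add)
  also have "\<dots> = g" using p per by (simp add: less_imp_le)
  finally have "(nxt ^^ (i mod p)) (rev_flag g) = rev_flag h"
    using funpow_nxt_rev[OF h, of "i mod p"] by simp
  moreover have "(nxt ^^ p) (rev_flag g) = rev_flag g"
    using funpow_nxt_rev[OF g, of p] per by simp
  ultimately have "(nxt ^^ i) (rev_flag g) = rev_flag h"
    using funpow_mod_eq[of p nxt "rev_flag g" i] by simp
  then have "(nxt ^^ i) (nxt (rev_flag g)) = nxt (rev_flag h)"
    by (metis funpow_swap1)
  then show "zz g (p - i mod p) = zz (nxt (rev_flag g)) i"
    unfolding zz_def by (cases h) (auto simp: h_def)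
qed

text \<open>\<open>zz_reverse\<close> allows any shift and any period of the edge sequence. As edges
  determine flags, such a period is also a period of the flag, and \<open>zz_reversed\<close>
  applies.\<close>

lemma zz_reverse_class:
  assumes f: "f \<in> flags"
  shows "zz_reverse (zz_class f) = zz_class (rev_flag f)"
proof (intro equalityI subsetI)
  fix y assume "y \<in> zz_reverse (zz_class f)"
  then obtain k p where y: "y = (\<lambda>i. zz ((nxt ^^ k) f) (p - i mod p))" and p: "p > 0"
    and per: "\<And>i. zz ((nxt ^^ k) f) (i + p) = zz ((nxt ^^ k) f) i"
    unfolding zz_reverse_def zz_class_eq by blast
  define g where "g = (nxt ^^ k) f"
  have g: "g \<in> flags" unfolding g_def by (rule funpow_nxt_flag[OF f])
  have "zz ((nxt ^^ p) g) = zz g"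
    using per unfolding zz_shift g_def by blast
  then have "(nxt ^^ p) g = g" by (rule zz_inj[OF funpow_nxt_flag[OF g] g])
  then have "y = zz (nxt (rev_flag g))" using zz_reversed[OF g p] y unfolding g_def by simp
  moreover have "zz_class (nxt (rev_flag g)) = zz_class (rev_flag f)"
    using zz_class_nxt zz_class_rev_funpow[OF f, of k] g unfolding g_def by simp
  ultimately show "y \<in> zz_class (rev_flag f)" using zz_in_zz_class by blast
next
  fix y assume "y \<in> zz_class (rev_flag f)"
  then obtain m where y: "y = zz ((nxt ^^ m) (rev_flag f))" unfolding zz_class_eq by blast
  have mf: "(nxt ^^ m) (rev_flag f) \<in> flags" using f funpow_nxt_flag by simp
  then obtain h where h: "h \<in> flags" "nxt h = (nxt ^^ m) (rev_flag f)" by (rule nxt_surj)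
  \<comment> \<open>The shift to be reversed is chosen so that \<open>nxt (rev_flag g)\<close>,
    which is \<open>nxt h\<close>, is the flag at which \<open>y\<close> starts.\<close>
  define g where "g = rev_flag h"
  have g: "g \<in> flags" using h unfolding g_def by simp
  have "zz_class h = zz_class (rev_flag f)"
    using zz_class_nxt[OF h(1)] zz_class_funpow[of "rev_flag f" m] f h(2) by simp
  then obtain k where "h = (nxt ^^ k) (rev_flag f)"
    using zz_class_eqD[of h "rev_flag f"] h(1) f by auto
  then have "zz_class g = zz_class f"
    using zz_class_rev_funpow[of "rev_flag f" k] f unfolding g_def by simp
  then have "zz g \<in> zz_class f" using zz_in_zz_class by blast
  moreover obtain p where p: "p > 0" "(nxt ^^ p) g = g" using nxt_period[OF g] by blast
  moreover have "zz g (i + p) = zz g i" for i unfolding zz_shift p(2) ..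
  moreover have "y = (\<lambda>i. zz g (p - i mod p))"
    unfolding zz_reversed[OF g p] using y h(2) unfolding g_def by simp
  ultimately show "y \<in> zz_reverse (zz_class f)" unfolding zz_reverse_def by blast
qed

section \<open>z-orientations as sets of flags\<close>

definition flags_of :: "(nat \<Rightarrow> 'v set) set set \<Rightarrow> ('v \<times> 'v \<times> 'v) set" where
  "flags_of \<tau> = {f \<in> flags. zz_class f \<in> \<tau>}"

lemma flags_of_flag: "(x, y, z) \<in> flags_of \<tau> \<Longrightarrow> {x, y, z} \<in> T"
  unfolding flags_of_def by simp

lemma nxt_flags_of: "f \<in> flags \<Longrightarrow> nxt f \<in> flags_of \<tau> \<longleftrightarrow> f \<in> flags_of \<tau>"
  unfolding flags_of_def by (simp add: zz_class_nxt nxt_flag)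

lemma z_orientation_iff_flags:
  "z_orientation T \<tau> \<longleftrightarrow> \<tau> = zz_class ` flags_of \<tau> \<and>
     (\<forall>f\<in>flags. f \<in> flags_of \<tau> \<longleftrightarrow> rev_flag f \<notin> flags_of \<tau>)"
proof -
  have "\<tau> \<subseteq> zz_class ` flags \<longleftrightarrow> \<tau> = zz_class ` flags_of \<tau>"
    unfolding flags_of_def by (blast elim: equalityE)
  then show ?thesis
    unfolding z_orientation_def zigzags_eq by (auto simp: zz_reverse_class flags_of_def)
qed

text \<open>A set of flags closed under \<open>nxt\<close> contains the whole orbit of each of its
  elements, so no flag is gained by passing to zigzag classes and back.\<close>

lemma z_orientation_of_flags:
  assumes S: "S \<subseteq> flags" and nxt: "\<And>f. f \<in> S \<Longrightarrow> nxt f \<in> S"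
    and rev: "\<And>f. f \<in> flags \<Longrightarrow> f \<in> S \<longleftrightarrow> rev_flag f \<notin> S"
  shows "flags_of (zz_class ` S) = S" "z_orientation T (zz_class ` S)"
proof -
  have pw: "f \<in> S \<Longrightarrow> (nxt ^^ k) f \<in> S" for f k
    by (induction k) (auto intro: nxt)
  show S_eq: "flags_of (zz_class ` S) = S"
  proof
    show "flags_of (zz_class ` S) \<subseteq> S"
    proof
      fix f assume "f \<in> flags_of (zz_class ` S)"
      then obtain g where "f \<in> flags" "g \<in> S" "zz_class f = zz_class g"
        unfolding flags_of_def by auto
      moreover then have "g \<in> flags" using S by blast
      ultimately obtain k where "f = (nxt ^^ k) g" using zz_class_eqD by blast
      then show "f \<in> S" using pw[OF \<open>g \<in> S\<close>] by simp
    qed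
    show "S \<subseteq> flags_of (zz_class ` S)" using S unfolding flags_of_def by auto
  qed
  show "z_orientation T (zz_class ` S)"
    unfolding z_orientation_iff_flags S_eq using rev by blast
qed

text \<open>A passage from \<open>a\<close> to \<open>b\<close> is a flag beginning with
  \<open>a\<close>, \<open>b\<close>. In \<open>zz_dirs\<close> the edge \<open>e\<close> is the
  second of three edges, so its flag is the successor of the flag of the first edge; conversely a
  flag has to be pulled back one step by \<open>nxt_surj\<close>.\<close>

lemma zz_dirs_iff:
  assumes \<tau>: "\<tau> \<subseteq> zigzags T"
  shows "(a, b) \<in> zz_dirs \<tau> e \<longleftrightarrow> e = {a, b} \<and> (\<exists>w. (a, b, w) \<in> flags_of \<tau>)"
proof
  assume "(a, b) \<in> zz_dirs \<tau> e"
  then obtain Z z i where Z: "Z \<in> \<tau>" "z \<in> Z" "z (Suc i) = e" "a \<in> z i \<inter> e" "b \<in> z (Suc (Suc i)) \<inter> e"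
    unfolding zz_dirs_def by blast
  then obtain f where f: "f \<in> flags" "Z = zz_class f" using \<tau> unfolding zigzags_eq by blast
  then obtain k where k: "z = zz ((nxt ^^ k) f)" using Z(2) unfolding zz_class_eq by blast
  define h where "h = (nxt ^^ (i + k)) f"
  have h: "h \<in> flags" unfolding h_def by (rule funpow_nxt_flag[OF f(1)])
  obtain x y u where xyu: "h = (x, y, u)" by (cases h) auto
  define v where "v = opp y u x"
  have zs: "z i = {x, y}" "z (Suc i) = {y, u}" "z (Suc (Suc i)) = {u, v}"
    using xyu unfolding k v_def zz_def h_def by (simp_all add: funpow_add)
  have nh: "nxt h = (y, u, v)" unfolding xyu v_def by simp
  then have "{y, u, v} \<in> T" using nxt_flag[OF h] by simp
  from face_distinct[OF this] have "a = y" "b = u"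
    using Z(3-5) zs face_distinct[of x y u] h xyu by auto
  moreover have "nxt h \<in> flags_of \<tau>"
    unfolding nxt_flags_of[OF h] using h f Z(1) zz_class_funpow[OF f(1)]
    unfolding flags_of_def h_def by simp
  ultimately show "e = {a, b} \<and> (\<exists>w. (a, b, w) \<in> flags_of \<tau>)"
    using zs Z(3) nh by auto
next
  assume "e = {a, b} \<and> (\<exists>w. (a, b, w) \<in> flags_of \<tau>)"
  then obtain w where w: "e = {a, b}" "(a, b, w) \<in> flags_of \<tau>" by blast
  then have "(a, b, w) \<in> flags" unfolding flags_of_def by blast
  then obtain g where g: "g \<in> flags" "nxt g = (a, b, w)" by (rule nxt_surj)
  obtain v where v: "g = (v, a, b)" using g(2) by (cases g) auto
  have "g \<in> flags_of \<tau>" using w nxt_flags_of[OF g(1)] g(2) by simp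
  then have "zz_class g \<in> \<tau>" unfolding flags_of_def by simp
  moreover have "zz g (Suc 0) = e" "zz g 0 = {v, a}" "zz g (Suc (Suc 0)) = {b, w}"
    using g(2) v w unfolding zz_def by simp_all
  ultimately show "(a, b) \<in> zz_dirs \<tau> e"
    unfolding zz_dirs_def using zz_in_zz_class[of g] w(1) by blast
qed

end

section \<open>Edge types in a z-orientation\<close>

lemma edge_typeI_not_typeII: "edge_typeI \<tau> e \<Longrightarrow> \<not> edge_typeII \<tau> e"
  unfolding edge_typeI_def edge_typeII_def by auto

locale z_oriented_pseudosurface = closed_pseudosurface T for T :: "'v set set" +
  fixes \<tau> :: "(nat \<Rightarrow> 'v set) set set"
  assumes z_orient: "z_orientation T \<tau>"
begin

abbreviation S :: "('v \<times> 'v \<times> 'v) set" where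
  "S \<equiv> flags_of \<tau>"

lemma tau_zigzags: "\<tau> \<subseteq> zigzags T"
  using z_orient unfolding z_orientation_def by blast

lemma S_rev: "{x, y, z} \<in> T \<Longrightarrow> (x, y, z) \<in> S \<longleftrightarrow> (z, y, x) \<notin> S"
proof -
  have "\<forall>f\<in>flags. f \<in> S \<longleftrightarrow> rev_flag f \<notin> S"
    using z_orient unfolding z_orientation_iff_flags by blast
  moreover assume "{x, y, z} \<in> T"
  ultimately show ?thesis by (metis flags_iff rev_flag.simps)
qed

lemma S_step: "{x, y, z} \<in> T \<Longrightarrow> (y, z, opp y z x) \<in> S \<longleftrightarrow> (x, y, z) \<in> S"
  using nxt_flags_of[of "(x, y, z)"] by simp

text \<open>Two flags begin with \<open>x\<close>, \<open>y\<close>, one on each side of the edge.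
  The one on the far side is the successor of \<open>(w, x, y)\<close>, so both passages can be read
  off inside the face \<open>{x, y, w}\<close>.\<close>

lemma zz_dirs_face:
  assumes T: "{x, y, w} \<in> T"
  shows "(x, y) \<in> zz_dirs \<tau> {x, y} \<longleftrightarrow> (x, y, w) \<in> S \<or> (w, x, y) \<in> S"
proof -
  have "(\<exists>v. (x, y, v) \<in> S) \<longleftrightarrow> (x, y, w) \<in> S \<or> (x, y, opp x y w) \<in> S"
    using opp_eq[OF T] flags_of_flag by metis
  moreover have "{w, x, y} \<in> T" using T by (simp add: insert_commute)
  ultimately show ?thesis
    unfolding zz_dirs_iff[OF tau_zigzags] using S_step[of w x y] by simp
qed

text \<open>For the direction from \<open>y\<close> to \<open>x\<close> the two relevant flags are
  the reversals of \<open>(w, x, y)\<close> and \<open>(x, y, w)\<close>; one of them lies in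
  \<open>S\<close> unless both of the latter do.\<close>

lemma zz_dirs_face_cases:
  assumes T: "{x, y, w} \<in> T"
  shows "zz_dirs \<tau> {x, y} = {(a, b). (a, b) = (x, y) \<and> ((x, y, w) \<in> S \<or> (w, x, y) \<in> S) \<or>
     (a, b) = (y, x) \<and> \<not> ((x, y, w) \<in> S \<and> (w, x, y) \<in> S)}" (is "_ = ?D")
proof -
  have T': "{y, x, w} \<in> T" "{w, x, y} \<in> T" using T by (simp_all add: insert_commute)
  have "(y, x) \<in> zz_dirs \<tau> {x, y} \<longleftrightarrow> (y, x, w) \<in> S \<or> (w, y, x) \<in> S"
    using zz_dirs_face[OF T'(1)] by (simp add: insert_commute)
  then have yx: "(y, x) \<in> zz_dirs \<tau> {x, y} \<longleftrightarrow> \<not> ((x, y, w) \<in> S \<and> (w, x, y) \<in> S)"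
    using S_rev[OF T] S_rev[OF T'(2)] by blast
  have "(a, b) \<in> zz_dirs \<tau> {x, y} \<longleftrightarrow> (a, b) \<in> ?D" for a b
  proof (cases "{a, b} = {x, y}")
    case True
    then have "(a, b) = (x, y) \<or> (a, b) = (y, x)" by (auto simp: doubleton_eq_iff)
    then show ?thesis using yx zz_dirs_face[OF T] face_distinct[OF T] by auto
  next
    case False
    then have "(a, b) \<notin> zz_dirs \<tau> {x, y}" unfolding zz_dirs_iff[OF tau_zigzags] by auto
    then show ?thesis using False by auto
  qed
  then show ?thesis by auto
qed

lemma typeI_iff:
  assumes T: "{x, y, w} \<in> T"
  shows "edge_typeI \<tau> {x, y} \<longleftrightarrow> ((x, y, w) \<in> S \<longleftrightarrow> (w, x, y) \<notin> S)"
proof -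
  have "x \<noteq> y" using face_distinct[OF T] by blast
  then show ?thesis
    unfolding edge_typeI_def zz_dirs_face_cases[OF T]
    by (cases "(x, y, w) \<in> S"; cases "(w, x, y) \<in> S") (auto simp: set_eq_iff)
qed

lemma typeII_arcs_iff:
  assumes T: "{x, y, w} \<in> T"
  shows "(x, y) \<in> typeII_arcs T \<tau> \<longleftrightarrow> (x, y, w) \<in> S \<and> (w, x, y) \<in> S"
proof -
  have "x \<noteq> y" using face_distinct[OF T] by blast
  then show ?thesis
    unfolding typeII_arcs_def using face_edges_of[OF T]
    by (cases "(x, y, w) \<in> S"; cases "(w, x, y) \<in> S") (auto simp: set_eq_iff zz_dirs_face_cases[OF T])
qed

lemma typeII_arcs_edge: "(x, y) \<in> typeII_arcs T \<tau> \<Longrightarrow> {x, y} \<in> edges_of T"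
  unfolding typeII_arcs_def by simp

lemma typeII_arcs_antisym:
  assumes "(x, y) \<in> typeII_arcs T \<tau>"
  shows "x \<noteq> y" "(y, x) \<notin> typeII_arcs T \<tau>"
proof -
  have "card {x, y} = 2" using assms unfolding typeII_arcs_def edges_of_def by simp
  then show "x \<noteq> y" by auto
  with assms show "(y, x) \<notin> typeII_arcs T \<tau>"
    unfolding typeII_arcs_def by (auto simp: insert_commute)
qed

text \<open>If not exactly one of \<open>(x, y, w)\<close> and \<open>(w, x, y)\<close> lies in
  \<open>S\<close>, then either both do, or neither does and both reversals do; these are the two
  possible arcs.\<close>

lemma not_typeI_iff:
  assumes "{x, y} \<in> edges_of T"
  shows "\<not> edge_typeI \<tau> {x, y} \<longleftrightarrow> (x, y) \<in> typeII_arcs T \<tau> \<or> (y, x) \<in> typeII_arcs T \<tau>"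
proof -
  obtain w where T: "{x, y, w} \<in> T" using assms by (rule edges_ofE)
  then have T': "{y, x, w} \<in> T" "{w, x, y} \<in> T" by (simp_all add: insert_commute)
  show ?thesis
    unfolding typeI_iff[OF T] typeII_arcs_iff[OF T] typeII_arcs_iff[OF T'(1)]
    using S_rev[OF T] S_rev[OF T'(2)] by blast
qed

lemma typeII_iff_not_typeI:
  assumes "{x, y} \<in> edges_of T"
  shows "edge_typeII \<tau> {x, y} \<longleftrightarrow> \<not> edge_typeI \<tau> {x, y}"
  using edge_typeI_not_typeII not_typeI_iff[OF assms]
  unfolding typeII_arcs_def edge_typeII_def by (auto simp: insert_commute)

text \<open>Homogeneity gives the pattern of period three for some sequence in the class. By
  periodicity the edges from \<open>f\<close> on are a shift of that sequence, and among three
  consecutive indices exactly one is divisible by 3.\<close>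

lemma homogeneous_consecutive:
  assumes hom: "\<forall>Z\<in>\<tau>. homogeneous \<tau> Z" and f: "(x, y, z) \<in> S"
  defines "w \<equiv> opp y z x"
  shows "(\<not> edge_typeI \<tau> {x, y} \<and> edge_typeI \<tau> {y, z} \<and> edge_typeI \<tau> {z, w}) \<or>
    (edge_typeI \<tau> {x, y} \<and> \<not> edge_typeI \<tau> {y, z} \<and> edge_typeI \<tau> {z, w}) \<or>
    (edge_typeI \<tau> {x, y} \<and> edge_typeI \<tau> {y, z} \<and> \<not> edge_typeI \<tau> {z, w})"
proof -
  define f where "f = (x, y, z)"
  have f: "f \<in> flags" "zz_class f \<in> \<tau>" using f unfolding flags_of_def f_def by auto
  then obtain u where u: "u \<in> zz_class f"
    and pat: "\<And>i. edge_typeII \<tau> (u (3*i)) \<and> edge_typeI \<tau> (u (3*i+1)) \<and> edge_typeI \<tau> (u (3*i+2))"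
    using hom unfolding homogeneous_def by blast
  have typ_u: "edge_typeI \<tau> (u j) \<longleftrightarrow> j mod 3 \<noteq> 0" for j
  proof -
    have "j = 3 * (j div 3) \<and> j mod 3 = 0 \<or> j = 3 * (j div 3) + 1 \<and> j mod 3 \<noteq> 0 \<or>
        j = 3 * (j div 3) + 2 \<and> j mod 3 \<noteq> 0"
      by presburger
    then show ?thesis
      using pat[of "j div 3"] edge_typeI_not_typeII[of \<tau> "u j"] by metis
  qed
  obtain k where k: "u = zz ((nxt ^^ k) f)" using u unfolding zz_class_eq by blast
  obtain n where n: "n > 0" "(nxt ^^ n) f = f" using nxt_period[OF f(1)] by blast
  have "(nxt ^^ (k * n)) f = f"
    using funpow_mod_eq[OF n(2), of "k * n"] by simp
  moreover have "k \<le> k * n" using n(1) by simp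
  \<comment> \<open>After \<open>k\<close> steps, \<open>k * n - k\<close> more steps complete
    \<open>k\<close> full periods and return to \<open>f\<close>.\<close>
  ultimately have "(nxt ^^ (k * n - k)) ((nxt ^^ k) f) = f"
    using funpow_add[of "k * n - k" k nxt] by (metis comp_apply le_add_diff_inverse2)
  then have "zz f i = u (i + (k * n - k))" for i
    unfolding k using zz_shift by metis
  moreover have "zz f 0 = {x, y}" "zz f 1 = {y, z}" "zz f 2 = {z, w}"
    unfolding zz_def f_def w_def by (simp_all add: numeral_2_eq_2)
  ultimately have e: "{x, y} = u (0 + (k * n - k))" "{y, z} = u (1 + (k * n - k))" "{z, w} = u (2 + (k * n - k))"
    by metis+
  show ?thesis unfolding e typ_u by presburger
qed

end

section \<open>The subgraph of type II\<close>

lemma triangulation_pseudosurface: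
  assumes "triangulation V T"
  shows "closed_pseudosurface T"
proof
  have "T \<subseteq> Pow V" "finite V" using assms unfolding triangulation_def by auto
  then show "finite T" by (meson finite_Pow_iff finite_subset)
qed (use assms in \<open>auto simp: triangulation_def\<close>)

locale homogeneous_triangulation = z_oriented_pseudosurface T \<tau> for T :: "'v set set" and \<tau> +
  fixes V :: "'v set"
  assumes triang: "triangulation V T"
    and faces_typeI: "t \<in> T \<Longrightarrow> face_typeI T \<tau> t"
    and zigzags_homogeneous: "\<forall>Z\<in>\<tau>. homogeneous \<tau> Z"
begin

section \<open>The arc of a face and its opposite vertex\<close>

abbreviation "arcs \<equiv> typeII_arcs T \<tau>"
abbreviation "verts \<equiv> typeII_vertices V T \<tau>"

text \<open>Eventually this says that \<open>c\<close> is the centre of a face of the type II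
  subgraph with the arc from \<open>a\<close> to \<open>b\<close> on its boundary.\<close>

definition apex :: "'v \<Rightarrow> 'v \<Rightarrow> 'v \<Rightarrow> bool" where
  "apex c a b \<longleftrightarrow> {a, b, c} \<in> T \<and> (a, b) \<in> arcs \<and> edge_typeI \<tau> {b, c} \<and> edge_typeI \<tau> {a, c}"

lemma face_subset: "t \<in> T \<Longrightarrow> t \<subseteq> V"
  using triang unfolding triangulation_def by blast

lemma face_has_apex:
  assumes t: "t \<in> T"
  obtains a b c where "t = {a, b, c}" "apex c a b"
proof -
  have "card {e \<in> edges_of T. e \<subseteq> t \<and> edge_typeII \<tau> e} = 1"
    using faces_typeI[OF t] unfolding face_typeI_def by blast
  then obtain e where e: "{e \<in> edges_of T. e \<subseteq> t \<and> edge_typeII \<tau> e} = {e}"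
    by (rule card_1_singletonE)
  then have "e \<in> {e \<in> edges_of T. e \<subseteq> t \<and> edge_typeII \<tau> e}" by simp
  then have e': "e \<in> edges_of T" "e \<subseteq> t" "edge_typeII \<tau> e" by auto
  then have "card e = 2" unfolding edges_of_def by simp
  then obtain x y where "e = {x, y}" by (auto simp: card_2_iff)
  with e' have "(x, y) \<in> arcs \<or> (y, x) \<in> arcs"
    using not_typeI_iff typeII_iff_not_typeI by simp
  then obtain a b where ab: "e = {a, b}" "(a, b) \<in> arcs"
    using \<open>e = {x, y}\<close> by (auto simp: insert_commute)
  have "card (t - {a, b}) = 1"
    using ab e' \<open>card e = 2\<close> card_face[OF t] by (subst card_Diff_subset) auto
  then obtain c where "t - {a, b} = {c}" by (rule card_1_singletonE)
  then have tc: "t = {a, b, c}" using e'(2) ab(1) by auto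
  have T: "{a, b, c} \<in> T" using t tc by simp
  note d = face_distinct[OF T]
  have "edge_typeI \<tau> s" if s: "s \<in> edges_of T" "s \<subseteq> t" "s \<noteq> e" for s
  proof (rule ccontr)
    assume "\<not> edge_typeI \<tau> s"
    moreover have "card s = 2" using s(1) unfolding edges_of_def by simp
    then obtain x y where "s = {x, y}" by (auto simp: card_2_iff)
    ultimately have "edge_typeII \<tau> s" using typeII_iff_not_typeI s(1) by simp
    then have "s \<in> {e}" unfolding e[symmetric] using s by simp
    then show False using s by simp
  qed
  moreover have "{b, c} \<noteq> e" "{a, c} \<noteq> e" using d ab by (auto simp: doubleton_eq_iff)
  ultimately have "apex c a b"
    unfolding apex_def using T ab(2) face_edges_of[OF T] tc by simp
  then show ?thesis using tc that by blast
qed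

text \<open>The arc gives the first two flags. As \<open>{b, c}\<close> is of type I and
  \<open>(a, b, c)\<close> lies in \<open>S\<close>, the flag \<open>(b, c, a)\<close> does not, so
  its reversal \<open>(a, c, b)\<close> does.\<close>

lemma apex_flags:
  assumes "apex c a b"
  shows "(a, b, c) \<in> S" "(c, a, b) \<in> S" "(a, c, b) \<in> S"
proof -
  have T: "{a, b, c} \<in> T" using assms unfolding apex_def by blast
  then have T': "{b, c, a} \<in> T" by (simp add: insert_commute)
  show 1: "(a, b, c) \<in> S" and "(c, a, b) \<in> S"
    using assms typeII_arcs_iff[OF T] unfolding apex_def by blast+
  show "(a, c, b) \<in> S"
    using assms 1 typeI_iff[OF T'] S_rev[OF T'] unfolding apex_def by blast
qed

lemma apex_rev_flags:
  assumes "apex c a b"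
  shows "(c, b, a) \<notin> S" "(b, a, c) \<notin> S" "(b, c, a) \<notin> S"
proof -
  have "{a, b, c} \<in> T" "{c, a, b} \<in> T" "{a, c, b} \<in> T"
    using assms unfolding apex_def by (simp_all add: insert_commute)
  then show "(c, b, a) \<notin> S" "(b, a, c) \<notin> S" "(b, c, a) \<notin> S"
    using apex_flags[OF assms] S_rev by blast+
qed

text \<open>The edge \<open>{a, b}\<close> must be the type II edge of its face, so only its
  direction is open; if it went from \<open>b\<close> to \<open>a\<close>, then
  \<open>apex_rev_flags\<close> would exclude both flags in the hypothesis.\<close>

lemma apexI:
  assumes T: "{a, b, c} \<in> T" and ab: "\<not> edge_typeI \<tau> {a, b}"
    and S: "(a, b, c) \<in> S \<or> (a, c, b) \<in> S"
  shows "apex c a b"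
proof -
  obtain a' b' c' where t: "{a, b, c} = {a', b', c'}" and ap: "apex c' a' b'"
    using face_has_apex[OF T] by blast
  have T': "{a', b', c'} \<in> T" using T t by simp
  note d = face_distinct[OF T] and d' = face_distinct[OF T']
  have I: "edge_typeI \<tau> {b', c'}" "edge_typeI \<tau> {a', c'}"
    using ap unfolding apex_def by auto
  have "c' = c"
  proof (rule ccontr)
    assume "c' \<noteq> c"
    moreover have "a \<in> {a', b', c'}" "b \<in> {a', b', c'}" "c' \<in> {a, b, c}"
      using t by blast+
    ultimately have "{a, b} = {b', c'} \<or> {a, b} = {a', c'}"
      using d by (auto simp: insert_commute)
    then show False using I ab by auto
  qed
  moreover have "a \<in> {a', b', c'}" "b \<in> {a', b', c'}" using t by blast+
  ultimately have "(a' = a \<and> b' = b) \<or> (a' = b \<and> b' = a)" using d by auto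
  then show ?thesis
  proof
    assume "a' = b \<and> b' = a"
    then have "apex c b a" using ap \<open>c' = c\<close> by simp
    from apex_rev_flags[OF this] show ?thesis using S by blast
  qed (use ap \<open>c' = c\<close> in simp)
qed

text \<open>The zigzag through \<open>(a, b, c)\<close> continues with \<open>{b, c}\<close> and
  \<open>{c, d}\<close>. Its edge \<open>{a, b}\<close> is of type II, so homogeneity makes
  \<open>{c, d}\<close> of type I, and the type II edge of the adjacent face is
  \<open>{b, d}\<close>. The flag \<open>(b, c, d)\<close> in \<open>S\<close> directs it away from
  \<open>b\<close>.\<close>

lemma apex_next:
  assumes ap: "apex c a b"
  obtains d where "d \<noteq> a" "apex c b d"
proof -
  have T: "{a, b, c} \<in> T" and I: "\<not> edge_typeI \<tau> {a, b}" "edge_typeI \<tau> {b, c}"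
    using ap not_typeI_iff typeII_arcs_edge unfolding apex_def by auto
  have T': "{b, c, a} \<in> T" using T by (simp add: insert_commute)
  define d where "d = opp b c a"
  have d: "d \<noteq> a" "{b, c, d} \<in> T" using opp_in[OF T'] unfolding d_def by auto
  have S: "(b, c, d) \<in> S" using apex_flags(1)[OF ap] S_step[OF T] unfolding d_def by blast
  have cd: "edge_typeI \<tau> {c, d}"
    using homogeneous_consecutive[OF zigzags_homogeneous apex_flags(1)[OF ap]] I
    unfolding d_def by blast
  have "\<not> edge_typeI \<tau> {b, d}"
  proof
    assume bd: "edge_typeI \<tau> {b, d}"
    obtain x y z where t: "{b, c, d} = {x, y, z}" "apex z x y" using face_has_apex[OF d(2)] .
    then have "{x, y} \<in> edges_of T" "\<not> edge_typeI \<tau> {x, y}" "x \<noteq> y"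
      using not_typeI_iff typeII_arcs_edge typeII_arcs_antisym unfolding apex_def by auto
    moreover have "x \<in> {b, c, d}" "y \<in> {b, c, d}" using t by blast+
    ultimately show False using bd cd I(2) by (auto simp: insert_commute)
  qed
  moreover have "{b, d, c} \<in> T" using d(2) by (simp add: insert_commute)
  ultimately have "apex c b d" using S by (intro apexI) auto
  then show ?thesis using d(1) that by blast
qed

text \<open>The argument of \<open>apex_next\<close> run backwards: in the zigzag with edges
  \<open>{a, b}\<close>, \<open>{b, c}\<close>, \<open>{c, d}\<close> the last two are of type I,
  hence the first is of type II.\<close>

lemma apex_prev:
  assumes ap: "apex c b d"
  obtains a where "apex c a b"
proof -
  have T: "{b, c, d} \<in> T" and I: "edge_typeI \<tau> {b, c}" "edge_typeI \<tau> {c, d}"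
    using ap unfolding apex_def by (simp_all add: insert_commute)
  define a where "a = opp b c d"
  have a: "a \<noteq> d" "{b, c, a} \<in> T" using opp_in[OF T] unfolding a_def by auto
  then have T': "{a, b, c} \<in> T" by (simp add: insert_commute)
  have d: "opp b c a = d" unfolding a_def by (rule opp_opp[OF T])
  then have S: "(a, b, c) \<in> S" using S_step[OF T'] apex_flags(3)[OF ap] by simp
  have "\<not> edge_typeI \<tau> {a, b}"
    using homogeneous_consecutive[OF zigzags_homogeneous S] I unfolding d by blast
  then have "apex c a b" using T' S by (intro apexI) auto
  then show ?thesis using that by blast
qed

text \<open>The edge \<open>{c, y}\<close> has only two faces, and these are the one with the arc
  leaving \<open>y\<close> and the one with the arc entering \<open>y\<close>.\<close>

lemma apex_neighbours:
  assumes "apex c y x" "apex c x' y" "{c, y, w} \<in> T"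
  shows "w = x \<or> w = x'"
proof -
  have T: "{c, y, x} \<in> T" "{c, y, x'} \<in> T" using assms unfolding apex_def by (simp_all add: insert_commute)
  have "x \<noteq> x'" using assms(1,2) typeII_arcs_antisym unfolding apex_def by blast
  then have "opp c y x = x'" using opp_eq[OF T(1)] T(2) by simp
  moreover have "w \<noteq> x \<Longrightarrow> opp c y x = w" using opp_eq[OF T(1)] assms(3) by simp
  ultimately show ?thesis by blast
qed

text \<open>A second successor \<open>b'\<close> of \<open>a\<close> would have to be the
  predecessor \<open>x\<close>, which would make \<open>x\<close> and \<open>a\<close> the ends of
  two opposite arcs.\<close>

lemma apex_fun:
  assumes "apex c a b" "apex c a b'"
  shows "b = b'"
proof -
  obtain x where x: "apex c x a" using apex_prev[OF assms(1)] .
  have "{c, a, b'} \<in> T" using assms(2) unfolding apex_def by (simp add: insert_commute)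
  from apex_neighbours[OF assms(1) x this] show ?thesis
    using assms(2) x typeII_arcs_antisym unfolding apex_def by blast
qed

lemma apex_inj:
  assumes "apex c a b" "apex c a' b"
  shows "a = a'"
proof -
  obtain x where x: "apex c b x" using apex_next[OF assms(1)] .
  have "{c, b, a'} \<in> T" using assms(2) unfolding apex_def by (simp add: insert_commute)
  from apex_neighbours[OF x assms(1) this] show ?thesis
    using assms(2) x typeII_arcs_antisym unfolding apex_def by blast
qed

lemma link_connected:
  assumes "v \<in> V" "{v, u} \<in> edges_of T" "{v, w} \<in> edges_of T"
  shows "(u, w) \<in> {(x, y). x \<noteq> y \<and> v \<notin> {x, y} \<and> {v, x, y} \<in> T}\<^sup>*"
  using triang assms unfolding triangulation_def by blast

text \<open>By \<open>apex_neighbours\<close>, a step in the link of \<open>c\<close> goes to the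
  successor or to the predecessor, and both again have a successor. Connectedness of the link
  spreads this to all neighbours of \<open>c\<close>.\<close>

lemma apex_around:
  assumes ap: "apex c a b" and u: "{c, u} \<in> edges_of T"
  shows "\<exists>x. apex c u x"
proof -
  have T: "{c, a, b} \<in> T" using ap unfolding apex_def by (simp add: insert_commute)
  then have "c \<in> V" using face_subset by blast
  from link_connected[OF this face_edges_of(1)[OF T] u] show ?thesis
  proof (induction rule: rtrancl_induct)
    case base
    show ?case using ap by blast
  next
    case (step y z)
    then obtain x where x: "apex c y x" by blast
    obtain x' where x': "apex c x' y" using apex_prev[OF x] .
    have "z = x \<or> z = x'" using apex_neighbours[OF x x'] step(2) by simp
    then show ?case using apex_next[OF x] x' by blast
  qed
qed

section \<open>Vertices of type II and centres\<close>

lemma arc_verts: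
  assumes "(a, b) \<in> arcs"
  shows "a \<in> verts" "b \<in> verts"
proof -
  have e: "{a, b} \<in> edges_of T" using assms by (rule typeII_arcs_edge)
  then have "\<not> edge_typeI \<tau> {a, b}" using not_typeI_iff assms by blast
  moreover have "{a, b} \<subseteq> V" using e face_subset unfolding edges_of_def by blast
  ultimately show "a \<in> verts" "b \<in> verts" using e unfolding typeII_vertices_def by auto
qed

lemma vertsE:
  assumes "v \<in> verts"
  obtains u where "{v, u} \<in> edges_of T" "(v, u) \<in> arcs \<or> (u, v) \<in> arcs"
proof -
  obtain e where e: "e \<in> edges_of T" "v \<in> e" "\<not> edge_typeI \<tau> e"
    using assms unfolding typeII_vertices_def by blast
  then have "card e = 2" unfolding edges_of_def by simp
  then obtain x y where "e = {x, y}" by (auto simp: card_2_iff)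
  then obtain u where "e = {v, u}" using e(2) by auto
  then show ?thesis using e not_typeI_iff that by blast
qed

text \<open>By \<open>apex_around\<close> every edge at \<open>c\<close> is a side of a face with
  apex \<open>c\<close>, hence of type I.\<close>

lemma apex_not_vert:
  assumes "apex c a b"
  shows "c \<notin> verts"
proof
  assume "c \<in> verts"
  then obtain u where u: "{c, u} \<in> edges_of T" "(c, u) \<in> arcs \<or> (u, c) \<in> arcs" by (rule vertsE)
  then have "\<not> edge_typeI \<tau> {c, u}" using not_typeI_iff by blast
  moreover obtain x where "apex c u x" using apex_around[OF assms u(1)] by blast
  ultimately show False unfolding apex_def by (simp add: insert_commute)
qed

lemma apex_iff: "apex c a b \<longleftrightarrow> {a, b, c} \<in> T \<and> (a, b) \<in> arcs \<and> c \<notin> verts"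
proof
  show "apex c a b \<Longrightarrow> {a, b, c} \<in> T \<and> (a, b) \<in> arcs \<and> c \<notin> verts"
    using apex_not_vert unfolding apex_def by blast
next
  assume as: "{a, b, c} \<in> T \<and> (a, b) \<in> arcs \<and> c \<notin> verts"
  then have T: "{a, b, c} \<in> T" by blast
  have "\<not> edge_typeI \<tau> {a, b}" using as not_typeI_iff typeII_arcs_edge by blast
  moreover have "(a, b, c) \<in> S" using typeII_arcs_iff[OF T] as by blast
  ultimately show "apex c a b" using T by (intro apexI) auto
qed

text \<open>In each face the ends of the arc are vertices of type II, so a vertex of type I can only
  be the apex.\<close>

lemma non_vert_apex:
  assumes "F \<in> V" "F \<notin> verts" "{F, u} \<in> edges_of T"
  shows "\<exists>b. apex F u b"
proof -
  obtain z where "{F, u, z} \<in> T" using edges_ofE[OF assms(3)] .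
  then obtain a b c where t: "{F, u, z} = {a, b, c}" "apex c a b" by (rule face_has_apex)
  then have "a \<in> verts" "b \<in> verts" using arc_verts unfolding apex_def by blast+
  moreover have "F \<in> {a, b, c}" using t by blast
  ultimately have "F = c" using assms(2) by auto
  then show ?thesis using apex_around t(2) assms(3) by blast
qed

section \<open>Boundary cycles and the two faces at an arc\<close>

lemma apex_nbr: "apex F a b \<Longrightarrow> {F, a} \<in> edges_of T \<and> {F, b} \<in> edges_of T"
  using face_edges_of[of a b F] unfolding apex_def by (simp add: insert_commute)

text \<open>The relation \<open>apex F\<close> is the graph of an injective successor map on the
  link of \<open>F\<close>, and connectedness of the link makes it a single cycle.\<close>

lemma face_cycle_ex:
  assumes F: "F \<in> V" "F \<notin> verts"
  shows "\<exists>l. distinct l \<and> set l = {u. {F, u} \<in> edges_of T} \<and> (\<forall>a b. cyc_adj l a b \<longleftrightarrow> apex F a b)"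
proof -
  let ?N = "{u. {F, u} \<in> edges_of T}"
  define s where "s a = (THE b. apex F a b)" for a
  have s: "apex F a b \<longleftrightarrow> a \<in> ?N \<and> b = s a" for a b
  proof
    assume ap: "apex F a b"
    then have "s a = b" unfolding s_def by (intro the_equality) (auto intro: apex_fun)
    then show "a \<in> ?N \<and> b = s a" using apex_nbr[OF ap] by simp
  next
    assume "a \<in> ?N \<and> b = s a"
    moreover then obtain x where x: "apex F a x" using non_vert_apex[OF F] by blast
    moreover have "s a = x" unfolding s_def by (intro the_equality) (use x in \<open>auto intro: apex_fun\<close>)
    ultimately show "apex F a b" by simp
  qed
  have edge_V: "e \<subseteq> V" if "e \<in> edges_of T" for e
    using that face_subset unfolding edges_of_def by blast
  have "?N \<subseteq> V" using edge_V by blast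
  moreover have "finite V" using triang unfolding triangulation_def by blast
  ultimately have fin: "finite ?N" by (rule finite_subset)
  have ne: "?N \<noteq> {}" using triang F(1) unfolding triangulation_def by blast
  have maps: "s a \<in> ?N" if "a \<in> ?N" for a
    using s[of a "s a"] that apex_nbr by blast
  have inj: "inj_on s ?N"
  proof (rule inj_onI)
    fix a b assume "a \<in> ?N" "b \<in> ?N" "s a = s b"
    then show "a = b" using s[of a "s a"] s[of b "s a"] apex_inj by blast
  qed
  have conn: "(u, w) \<in> {(x, y). x \<in> ?N \<and> y \<in> ?N \<and> (y = s x \<or> x = s y)}\<^sup>*" if "u \<in> ?N" "w \<in> ?N" for u w
  proof -
    have "(x, y) \<in> {(x, y). x \<in> ?N \<and> y \<in> ?N \<and> (y = s x \<or> x = s y)}" if "{F, x, y} \<in> T" for x y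
    proof -
      have N: "x \<in> ?N" "y \<in> ?N" using face_edges_of[OF that] by simp_all
      then obtain z where z: "apex F x z" using non_vert_apex[OF F] by blast
      obtain z' where z': "apex F z' x" using apex_prev[OF z] .
      have "y = z \<or> y = z'" using apex_neighbours[OF z z' that] .
      then show ?thesis using z z' N s by auto
    qed
    then have "{(x, y). x \<noteq> y \<and> F \<notin> {x, y} \<and> {F, x, y} \<in> T} \<subseteq>
        {(x, y). x \<in> ?N \<and> y \<in> ?N \<and> (y = s x \<or> x = s y)}" by blast
    moreover have "(u, w) \<in> {(x, y). x \<noteq> y \<and> F \<notin> {x, y} \<and> {F, x, y} \<in> T}\<^sup>*"
      using link_connected[OF F(1)] that by simp
    ultimately show ?thesis using rtrancl_mono by blast
  qed
  show ?thesis
    using cyc_list_of_permutation[OF fin ne maps inj conn] unfolding s by blast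
qed

definition bd :: "'v \<Rightarrow> 'v list" where
  "bd F = (SOME l. distinct l \<and> set l = {u. {F, u} \<in> edges_of T} \<and> (\<forall>a b. cyc_adj l a b \<longleftrightarrow> apex F a b))"

lemma bd:
  assumes "F \<in> V - verts"
  shows "distinct (bd F)" "set (bd F) = {u. {F, u} \<in> edges_of T}" "cyc_adj (bd F) a b \<longleftrightarrow> apex F a b"
proof -
  have "F \<in> V" "F \<notin> verts" using assms by auto
  note someI_ex[OF face_cycle_ex[OF this], folded bd_def]
  then show "distinct (bd F)" "set (bd F) = {u. {F, u} \<in> edges_of T}" "cyc_adj (bd F) a b \<longleftrightarrow> apex F a b"
    by blast+
qed

lemma apex_in: "apex F a b \<Longrightarrow> F \<in> V - verts"
  using face_subset[of "{a, b, F}"] unfolding apex_iff by auto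

lemma arc_face_iff_apex:
  assumes "(a, b) \<in> arcs"
  shows "{a, b, F} \<in> T \<longleftrightarrow> apex F a b"
proof
  assume T: "{a, b, F} \<in> T"
  have "\<not> edge_typeI \<tau> {a, b}" using assms not_typeI_iff typeII_arcs_edge by blast
  moreover have "(a, b, F) \<in> S" using typeII_arcs_iff[OF T] assms by blast
  ultimately show "apex F a b" using T by (intro apexI) auto
qed (simp add: apex_def)

text \<open>The two triangles at the edge \<open>{a, b}\<close> have distinct apexes, and these name
  the two faces of the subgraph at the arc.\<close>

lemma arc_card_apex:
  assumes "(a, b) \<in> arcs"
  shows "card {F. apex F a b} = 2"
proof -
  obtain w where T: "{a, b, w} \<in> T" using edges_ofE[OF typeII_arcs_edge[OF assms]] .
  have "{F. apex F a b} = {F. {a, b, F} \<in> T}" using arc_face_iff_apex[OF assms] by blast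
  also have "\<dots> = {w, opp a b w}"
  proof (intro equalityI subsetI)
    fix F assume "F \<in> {F. {a, b, F} \<in> T}"
    then show "F \<in> {w, opp a b w}" using opp_eq[OF T, of F] by auto
  qed (use T opp_in[OF T] in auto)
  also have "card \<dots> = 2" using opp_in(1)[OF T] by auto
  finally show ?thesis .
qed

text \<open>Exactly one vertex of each triangle is of type I, namely its apex.\<close>

lemma face_verts:
  assumes "{x, y, z} \<in> T"
  shows "x \<notin> verts \<Longrightarrow> y \<in> verts \<and> z \<in> verts" "x \<in> verts \<Longrightarrow> y \<in> verts \<Longrightarrow> z \<notin> verts"
proof -
  obtain a b c where t: "{x, y, z} = {a, b, c}" "apex c a b" using face_has_apex[OF assms] .
  have v: "a \<in> verts" "b \<in> verts" "c \<notin> verts"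
    using t(2) arc_verts unfolding apex_iff by blast+
  have d: "x \<noteq> y" "y \<noteq> z" "x \<noteq> z" using face_distinct[OF assms] .
  have m: "x \<in> {a, b, c}" "y \<in> {a, b, c}" "z \<in> {a, b, c}" "c \<in> {x, y, z}" using t(1) by blast+
  show "x \<notin> verts \<Longrightarrow> y \<in> verts \<and> z \<in> verts" using m d v by auto
  show "x \<in> verts \<Longrightarrow> y \<in> verts \<Longrightarrow> z \<notin> verts" using m d v by auto
qed

section \<open>Connectedness of the rotations and of the subgraph\<close>

lemma edge_verts: "{x, z} \<in> edges_of T \<Longrightarrow> x \<notin> verts \<Longrightarrow> z \<in> verts"
  using face_verts(1) edges_ofE by metis

text \<open>The link of \<open>v\<close> in the triangulation alternates between vertices of type II
  and centres. Leaving out the centres turns a walk in this link into a walk in the rotation at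
  \<open>v\<close>.\<close>

lemma vertex_rotation_connected:
  assumes v: "v \<in> verts" and u: "{v, u} \<in> underlying arcs" and w: "{v, w} \<in> underlying arcs"
  shows "(u, w) \<in> {(x, y). \<exists>F\<in>V - verts. (apex F x v \<and> apex F v y) \<or> (apex F y v \<and> apex F v x)}\<^sup>*"
    (is "_ \<in> ?R\<^sup>*")
proof -
  have arcs_edge: "{v, x} \<in> edges_of T" "x \<in> verts" if "{v, x} \<in> underlying arcs" for x
    using that typeII_arcs_edge[of v x] typeII_arcs_edge[of x v] arc_verts[of v x] arc_verts[of x v]
    unfolding underlying_iff by (auto simp: insert_commute[of x v])
  have "v \<in> V" using v unfolding typeII_vertices_def by simp
  from link_connected[OF this arcs_edge(1)[OF u] arcs_edge(1)[OF w]]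
  \<comment> \<open>While the walk stands at a centre, the invariant asserts that both link
    neighbours of that centre are reachable, so the next step is already prepared.\<close>
  have "(w \<in> verts \<longrightarrow> (u, w) \<in> ?R\<^sup>*) \<and> (w \<notin> verts \<longrightarrow> (\<forall>y. {v, w, y} \<in> T \<longrightarrow> (u, y) \<in> ?R\<^sup>*))"
  proof (induction rule: rtrancl_induct)
    case base
    show ?case using arcs_edge(2)[OF u] by simp
  next
    case (step x z)
    then have T: "{v, x, z} \<in> T" by simp
    show ?case
    proof (cases "x \<in> verts")
      case True
      then have z: "z \<notin> verts" using face_verts(2)[OF T] v by blast
      have T': "{z, v, x} \<in> T" using T by (simp add: insert_commute)
      then have "z \<in> V" using face_subset by blast
      then obtain b where b: "apex z v b" using non_vert_apex[OF _ z] face_edges_of(1)[OF T'] by blast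
      obtain a where a: "apex z a v" using apex_prev[OF b] .
      have "(u, y) \<in> ?R\<^sup>*" if "{v, z, y} \<in> T" for y
      proof -
        have "{z, v, y} \<in> T" using that by (simp add: insert_commute)
        then have y: "y = b \<or> y = a" by (rule apex_neighbours[OF b a])
        have x: "x = b \<or> x = a" by (rule apex_neighbours[OF b a T'])
        \<comment> \<open>Both \<open>x\<close> and \<open>y\<close> are among the predecessor
          \<open>a\<close> and the successor \<open>b\<close> of \<open>v\<close> on the boundary of
          \<open>z\<close>.\<close>
        have "x = y \<or> (x, y) \<in> ?R" using x y a b apex_in[OF a] by blast
        moreover have "(u, x) \<in> ?R\<^sup>*" using step True by blast
        ultimately show ?thesis by (elim disjE) (simp, rule rtrancl_into_rtrancl)
      qed
      then show ?thesis using z by blast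
    next
      case False
      have "{x, v, z} \<in> T" using T by (simp add: insert_commute)
      then have "z \<in> verts" using face_verts(1) False by blast
      then show ?thesis using step False T by blast
    qed
  qed
  then show ?thesis using arcs_edge(2)[OF w] by blast
qed

lemma verts_connected:
  assumes u: "u \<in> verts" and w: "w \<in> verts"
  shows "(u, w) \<in> {(x, y). {x, y} \<in> underlying arcs}\<^sup>*" (is "_ \<in> ?R\<^sup>*")
proof -
  have "(u, w) \<in> {(x, y). {x, y} \<in> edges_of T}\<^sup>*"
    using triang u w unfolding triangulation_def typeII_vertices_def by blast
  \<comment> \<open>At a centre the invariant claims that all its neighbours are reachable, which
    allows walks through centres to be rerouted.\<close>
  then have "(w \<in> verts \<longrightarrow> (u, w) \<in> ?R\<^sup>*) \<and> (w \<notin> verts \<longrightarrow> (\<forall>y. {w, y} \<in> edges_of T \<longrightarrow> (u, y) \<in> ?R\<^sup>*))"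
  proof (induction rule: rtrancl_induct)
    case base
    show ?case using u by simp
  next
    case (step x z)
    then have xz: "{x, z} \<in> edges_of T" by simp
    show ?case
    proof (cases "x \<in> verts")
      case x: True
      then have ux: "(u, x) \<in> ?R\<^sup>*" using step by blast
      show ?thesis
      proof (cases "z \<in> verts")
        case z: True
        \<comment> \<open>The third vertex of a face at \<open>{x, z}\<close> is a centre, so
          \<open>{x, z}\<close> is an arc in one of its two directions.\<close>
        obtain c where T: "{x, z, c} \<in> T" using edges_ofE[OF xz] .
        then have c: "c \<notin> verts" "c \<in> V" using face_verts(2)[OF T x z] face_subset[OF T] by blast+
        have T': "{c, x, z} \<in> T" using T by (simp add: insert_commute)
        obtain b where b: "apex c x b" using non_vert_apex[OF c(2,1) face_edges_of(1)[OF T']] by blast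
        obtain a where a: "apex c a x" using apex_prev[OF b] .
        have "z = b \<or> z = a" using apex_neighbours[OF b a T'] .
        then have "(x, z) \<in> ?R" using a b unfolding apex_def by (auto simp: underlying_iff)
        with ux have "(u, z) \<in> ?R\<^sup>*" by (rule rtrancl_into_rtrancl)
        then show ?thesis using z by blast
      next
        case False
        have "z \<in> V" using xz face_subset unfolding edges_of_def by blast
        then have zF: "z \<in> V - verts" using False by blast
        \<comment> \<open>The passage through the centre \<open>z\<close> is replaced by a path on
          its boundary cycle, which contains all neighbours of \<open>z\<close>.\<close>
        have "{(a, b). cyc_adj (bd z) a b} \<subseteq> ?R"
          using bd(3)[OF zF] unfolding apex_def by (auto simp: underlying_iff)
        then have sub: "{(a, b). cyc_adj (bd z) a b}\<^sup>* \<subseteq> ?R\<^sup>*" by (rule rtrancl_mono)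
        have "(u, y) \<in> ?R\<^sup>*" if "{z, y} \<in> edges_of T" for y
        proof -
          have "x \<in> set (bd z)" "y \<in> set (bd z)"
            using xz that unfolding bd(2)[OF zF] by (simp_all add: insert_commute)
          then have "(x, y) \<in> ?R\<^sup>*" by (rule subsetD[OF sub cyc_adj_connected])
          with ux show ?thesis by (rule rtrancl_trans)
        qed
        then show ?thesis using False by blast
      qed
    next
      case False
      then have "z \<in> verts" using edge_verts[OF xz] by blast
      then show ?thesis using step False xz by blast
    qed
  qed
  then show ?thesis using w by blast
qed

section \<open>The Euler condition and the embedding\<close>

lemma finite_V: "finite V"
  using triang unfolding triangulation_def by blast

lemma finite_verts: "finite verts"
  using finite_V unfolding typeII_vertices_def by simp

text \<open>Double counting: every face at \<open>v\<close> has one arc into \<open>v\<close> and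
  one arc out of \<open>v\<close>, and every arc lies on two faces. So the number of faces at
  \<open>v\<close> is twice the in-degree and twice the out-degree.\<close>

lemma typeII_eulerian: "eulerian verts arcs"
  unfolding eulerian_def
proof
  fix v assume "v \<in> verts"
  let ?In = "{u. (u, v) \<in> arcs}" and ?Out = "{w. (v, w) \<in> arcs}"
  let ?Q = "{F. \<exists>u. apex F u v}"
  have Q: "?Q = {F. \<exists>w. apex F v w}" by (blast elim: apex_next apex_prev)
  have "?In \<subseteq> verts" "?Out \<subseteq> verts" using arc_verts by blast+
  then have fin: "finite ?In" "finite ?Out" using finite_verts finite_subset by blast+
  have "?Q \<subseteq> V" using apex_in by blast
  then have finQ: "finite ?Q" using finite_V by (rule finite_subset)
  have "{u \<in> ?In. apex F u v} = {u0}" if "apex F u0 v" for F u0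
    using that apex_inj[OF that] unfolding apex_def by blast
  then have "\<forall>F\<in>?Q. card {u \<in> ?In. apex F u v} = 1" by fastforce
  from sum_multicount[OF fin(1) finQ this]
  have "(\<Sum>u\<in>?In. card {F \<in> ?Q. apex F u v}) = card ?Q" by simp
  moreover have "card {F \<in> ?Q. apex F u v} = 2" if "u \<in> ?In" for u
  proof -
    have "{F \<in> ?Q. apex F u v} = {F. apex F u v}" by blast
    then show ?thesis using arc_card_apex that by simp
  qed
  ultimately have in_count: "2 * card ?In = card ?Q" by simp
  have "{w \<in> ?Out. apex F v w} = {w0}" if "apex F v w0" for F w0
    using that apex_fun[OF that] unfolding apex_def by blast
  then have "\<forall>F\<in>?Q. card {w \<in> ?Out. apex F v w} = 1" unfolding Q by fastforce
  from sum_multicount[OF fin(2) finQ this]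
  have "(\<Sum>w\<in>?Out. card {F \<in> ?Q. apex F v w}) = card ?Q" by simp
  moreover have "card {F \<in> ?Q. apex F v w} = 2" if "w \<in> ?Out" for w
  proof -
    have "{F \<in> ?Q. apex F v w} = {F. apex F v w}" unfolding Q by blast
    then show ?thesis using arc_card_apex that by simp
  qed
  ultimately have "2 * card ?Out = card ?Q" by simp
  with in_count show "card ?In = card ?Out" by simp
qed

lemma typeII_closed_2cell_embedding:
  "closed_2cell_embedding verts (underlying arcs) (V - verts) bd"
  unfolding closed_2cell_embedding_def
proof (intro conjI ballI allI impI)
  show "finite verts" by (rule finite_verts)
  show "finite (V - verts)" using finite_V by simp
  obtain v u where "{v, u} \<in> edges_of T" using triang unfolding triangulation_def by blast
  then obtain z where "{v, u, z} \<in> T" by (rule edges_ofE)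
  then obtain a b c where "apex c a b" by (rule face_has_apex)
  then show "verts \<noteq> {}" using arc_verts unfolding apex_def by blast
next
  fix e assume "e \<in> underlying arcs"
  then obtain a b where e: "e = {a, b}" "(a, b) \<in> arcs" by (rule underlyingE)
  show "card e = 2" using typeII_arcs_antisym[OF e(2)] e(1) by simp
  show "e \<subseteq> verts" using arc_verts[OF e(2)] e(1) by simp
  have "{F \<in> V - verts. e \<in> face_edges (bd F)} = {F. apex F a b}"
  proof (intro equalityI subsetI)
    fix F assume "F \<in> {F \<in> V - verts. e \<in> face_edges (bd F)}"
    then have "F \<in> V - verts" "e \<in> face_edges (bd F)" by auto
    then have "apex F a b \<or> apex F b a" using bd(3) e(1) by (simp add: face_edges_iff)
    then show "F \<in> {F. apex F a b}"
      using typeII_arcs_antisym[OF e(2)] unfolding apex_def by blast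
  next
    fix F assume "F \<in> {F. apex F a b}"
    then have "apex F a b" by simp
    with apex_in[OF this] show "F \<in> {F \<in> V - verts. e \<in> face_edges (bd F)}"
      using bd(3) e(1) by (simp add: face_edges_iff)
  qed
  then show "card {F \<in> V - verts. e \<in> face_edges (bd F)} = 2" using arc_card_apex[OF e(2)] by simp
next
  fix F assume F: "F \<in> V - verts"
  show "distinct (bd F)" by (rule bd(1)[OF F])
  show "face_edges (bd F) \<subseteq> underlying arcs"
    using bd(3)[OF F] unfolding face_edges_def apex_def underlying_def by blast
  obtain u where "{F, u} \<in> edges_of T" using triang F unfolding triangulation_def by blast
  then obtain b where b: "apex F u b" using non_vert_apex F by blast
  \<comment> \<open>Three consecutive boundary vertices; \<open>apex_next\<close> supplies a
    \<open>d\<close> different from \<open>u\<close>, which gives length at least 3.\<close>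
  then obtain d where d: "d \<noteq> u" "apex F b d" by (rule apex_next)
  have "u \<noteq> b" "b \<noteq> d" using b d typeII_arcs_antisym unfolding apex_def by blast+
  then have "card {u, b, d} = 3" using d(1) by simp
  moreover have "{u, b, d} \<subseteq> set (bd F)"
    using bd(2)[OF F] apex_nbr[OF b] apex_nbr[OF d(2)] by simp
  ultimately have "3 \<le> card (set (bd F))" by (metis List.finite_set card_mono)
  then show "3 \<le> length (bd F)" using card_length le_trans by blast
next
  fix v assume v: "v \<in> verts"
  then obtain u where "(v, u) \<in> arcs \<or> (u, v) \<in> arcs" by (rule vertsE)
  then show "\<exists>u. {v, u} \<in> underlying arcs" by (auto simp: underlying_iff)
  fix u w assume "{v, u} \<in> underlying arcs" "{v, w} \<in> underlying arcs"
  note vertex_rotation_connected[OF v this]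
  also have "{(x, y). \<exists>F\<in>V - verts. (apex F x v \<and> apex F v y) \<or> (apex F y v \<and> apex F v x)} =
      {(x, y). \<exists>F\<in>V - verts. cyc_adj (bd F) x v \<and> cyc_adj (bd F) v y \<or> cyc_adj (bd F) y v \<and> cyc_adj (bd F) v x}"
    using bd(3) by auto
  finally show "(u, w) \<in> {(x, y). \<exists>F\<in>V - verts. cyc_adj (bd F) x v \<and> cyc_adj (bd F) v y \<or>
      cyc_adj (bd F) y v \<and> cyc_adj (bd F) v x}\<^sup>*" .
next
  fix u w assume "u \<in> verts" "w \<in> verts"
  then show "(u, w) \<in> {(x, y). {x, y} \<in> underlying arcs}\<^sup>*" by (rule verts_connected)
qed

lemma typeII_eulerian_dir_embedding: "eulerian_dir_embedding verts arcs (V - verts) bd"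
  unfolding eulerian_dir_embedding_def
proof (intro conjI)
  show "simple_digraph verts arcs"
    unfolding simple_digraph_def by (auto intro: arc_verts dest: typeII_arcs_antisym)
  show "directed_faces arcs (V - verts) bd"
    unfolding directed_faces_def using bd(3) unfolding apex_def by blast
qed (rule typeII_closed_2cell_embedding typeII_eulerian)+

section \<open>Reconstruction of the triangulation\<close>

lemma faces_eq_T_tris: "T = (\<lambda>t. case_sum id id ` t) ` T_tris (V - verts) bd"
proof (intro equalityI subsetI)
  fix t assume "t \<in> T"
  then obtain a b c where t: "t = {a, b, c}" "apex c a b" by (rule face_has_apex)
  have "{Inr c, Inl a, Inl b} \<in> T_tris (V - verts) bd"
    unfolding T_tris_def using bd(3)[OF apex_in[OF t(2)]] t(2) apex_in[OF t(2)] by blast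
  moreover have "t = case_sum id id ` {Inr c, Inl a, Inl b}" using t(1) by auto
  ultimately show "t \<in> (\<lambda>t. case_sum id id ` t) ` T_tris (V - verts) bd" by blast
next
  fix t assume "t \<in> (\<lambda>t. case_sum id id ` t) ` T_tris (V - verts) bd"
  then obtain F a b where F: "F \<in> V - verts" "cyc_adj (bd F) a b"
    and t: "t = case_sum id id ` {Inr F, Inl a, Inl b}" unfolding T_tris_def by blast
  have "{a, b, F} \<in> T" using F bd(3) unfolding apex_def by blast
  moreover have "t = {a, b, F}" using t by auto
  ultimately show "t \<in> T" by simp
qed

text \<open>Each face of the subgraph is named by its centre, so the face set is
  \<open>V - verts\<close>. The identification \<open>case_sum id id\<close> merely removes the tags
  that separate vertices from faces.\<close>

lemma typeII_reconstruction:
  "\<exists>(Fs :: 'v set) bd h. eulerian_dir_embedding verts arcs Fs bd \<and> bij_betw h (T_verts verts Fs) V \<and>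
     (\<forall>v\<in>verts. h (Inl v) = v) \<and> T = (\<lambda>t. h ` t) ` T_tris Fs bd"
proof (intro exI conjI)
  show "eulerian_dir_embedding verts arcs (V - verts) bd" by (rule typeII_eulerian_dir_embedding)
  show "T = (\<lambda>t. case_sum id id ` t) ` T_tris (V - verts) bd" by (rule faces_eq_T_tris)
  have "verts \<subseteq> V" unfolding typeII_vertices_def by blast
  then show "bij_betw (case_sum id id) (T_verts verts (V - verts)) V"
    unfolding bij_betw_def inj_on_def T_verts_def by (auto simp: image_Un image_image)
qed simp

end

section \<open>The triangulation of a directed embedding\<close>

locale directed_embedding =
  fixes V :: "'a set" and A :: "('a \<times> 'a) set" and Fs :: "'f set" and bd :: "'f \<Rightarrow> 'a list"
  assumes embedding: "eulerian_dir_embedding V A Fs bd"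
begin

abbreviation T :: "('a + 'f) set set" where
  "T \<equiv> T_tris Fs bd"

text \<open>The boundary list of a face may run along the arcs or against them. This relation lists
  the boundary in the direction of the arcs in either case.\<close>

definition arc_on :: "'f \<Rightarrow> 'a \<Rightarrow> 'a \<Rightarrow> bool" where
  "arc_on F a b \<longleftrightarrow> F \<in> Fs \<and> (a, b) \<in> A \<and> (cyc_adj (bd F) a b \<or> cyc_adj (bd F) b a)"

section \<open>Arcs on the boundary of a face\<close>

lemma arc_simple:
  assumes "(a, b) \<in> A"
  shows "a \<noteq> b" "(b, a) \<notin> A" "a \<in> V" "b \<in> V"
  using assms embedding unfolding eulerian_dir_embedding_def simple_digraph_def by auto

lemma arc_on_arc: "arc_on F a b \<Longrightarrow> (a, b) \<in> A"
  unfolding arc_on_def by simp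

lemma cell_embedding: "closed_2cell_embedding V (underlying A) Fs bd"
  using embedding unfolding eulerian_dir_embedding_def by blast

lemma bd_distinct: "F \<in> Fs \<Longrightarrow> distinct (bd F)"
  and bd_length: "F \<in> Fs \<Longrightarrow> length (bd F) \<ge> 3"
  using cell_embedding unfolding closed_2cell_embedding_def by blast+

lemma arc_on_cases:
  assumes F: "F \<in> Fs"
  obtains "\<And>a b. arc_on F a b \<longleftrightarrow> cyc_adj (bd F) a b" | "\<And>a b. arc_on F a b \<longleftrightarrow> cyc_adj (bd F) b a"
proof -
  have "(\<forall>a b. cyc_adj (bd F) a b \<longrightarrow> (a, b) \<in> A) \<or> (\<forall>a b. cyc_adj (bd F) a b \<longrightarrow> (b, a) \<in> A)"
    using embedding F unfolding eulerian_dir_embedding_def directed_faces_def by blast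
  then show ?thesis
  proof
    assume "\<forall>a b. cyc_adj (bd F) a b \<longrightarrow> (a, b) \<in> A"
    then have "arc_on F a b \<longleftrightarrow> cyc_adj (bd F) a b" for a b
      using F arc_simple(2) unfolding arc_on_def by blast
    then show ?thesis using that(1) by blast
  next
    assume "\<forall>a b. cyc_adj (bd F) a b \<longrightarrow> (b, a) \<in> A"
    then have "arc_on F a b \<longleftrightarrow> cyc_adj (bd F) b a" for a b
      using F arc_simple(2) unfolding arc_on_def by blast
    then show ?thesis using that(2) by blast
  qed
qed

lemma arc_on_face: "arc_on F a b \<Longrightarrow> F \<in> Fs"
  unfolding arc_on_def by simp

lemma cyc_adj_imp_arc_on:
  assumes "F \<in> Fs" "cyc_adj (bd F) a b"
  shows "arc_on F a b \<or> arc_on F b a"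
  using assms(2) by (cases rule: arc_on_cases[OF assms(1)]) auto

lemma arc_on_fun:
  assumes "arc_on F a b" "arc_on F a c"
  shows "b = c"
proof (rule arc_on_cases[OF arc_on_face[OF assms(1)]])
  show ?thesis if "\<And>a b. arc_on F a b \<longleftrightarrow> cyc_adj (bd F) a b"
    using assms cyc_adj_fun[OF bd_distinct[OF arc_on_face[OF assms(1)]]] unfolding that by blast
  show ?thesis if "\<And>a b. arc_on F a b \<longleftrightarrow> cyc_adj (bd F) b a"
    using assms cyc_adj_inj[OF bd_distinct[OF arc_on_face[OF assms(1)]]] unfolding that by blast
qed

lemma arc_on_inj:
  assumes "arc_on F a c" "arc_on F b c"
  shows "a = b"
proof (rule arc_on_cases[OF arc_on_face[OF assms(1)]])
  show ?thesis if "\<And>a b. arc_on F a b \<longleftrightarrow> cyc_adj (bd F) a b"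
    using assms cyc_adj_inj[OF bd_distinct[OF arc_on_face[OF assms(1)]]] unfolding that by blast
  show ?thesis if "\<And>a b. arc_on F a b \<longleftrightarrow> cyc_adj (bd F) b a"
    using assms cyc_adj_fun[OF bd_distinct[OF arc_on_face[OF assms(1)]]] unfolding that by blast
qed

lemma arc_on_in_set: "arc_on F a b \<Longrightarrow> a \<in> set (bd F) \<and> b \<in> set (bd F)"
  using cyc_adj_in_set[of "bd F" a b] cyc_adj_in_set[of "bd F" b a] unfolding arc_on_def by blast

lemma arc_on_at:
  assumes F: "F \<in> Fs" and a: "a \<in> set (bd F)"
  shows "\<exists>b. arc_on F a b" "\<exists>b. arc_on F b a"
proof -
  obtain b where b: "cyc_adj (bd F) a b" using cyc_adj_succ[OF a] .
  obtain c where c: "cyc_adj (bd F) c a" using cyc_adj_pred[OF a] .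
  show "\<exists>b. arc_on F a b" "\<exists>b. arc_on F b a"
    using b c by (cases rule: arc_on_cases[OF F]; auto)+
qed

lemma arc_on_next: "arc_on F a b \<Longrightarrow> \<exists>c. arc_on F b c"
  and arc_on_prev: "arc_on F a b \<Longrightarrow> \<exists>c. arc_on F c a"
  using arc_on_at(1)[OF arc_on_face, of F a b b] arc_on_at(2)[OF arc_on_face, of F a b a]
    arc_on_in_set[of F a b] by blast+

lemma arc_card_faces:
  assumes "(a, b) \<in> A"
  shows "card {F. arc_on F a b} = 2"
proof -
  have "{a, b} \<in> underlying A" using assms by (simp add: underlying_iff)
  then have "card {F \<in> Fs. {a, b} \<in> face_edges (bd F)} = 2"
    using cell_embedding unfolding closed_2cell_embedding_def by blast
  also have "{F \<in> Fs. {a, b} \<in> face_edges (bd F)} = {F. arc_on F a b}"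
    using assms unfolding arc_on_def face_edges_iff by auto
  finally show ?thesis .
qed

lemma arc_on_ex:
  assumes "(a, b) \<in> A"
  obtains F where "arc_on F a b"
proof -
  have "{F. arc_on F a b} \<noteq> {}" using arc_card_faces[OF assms] by (metis card.empty zero_neq_numeral)
  then show ?thesis using that by blast
qed

section \<open>The faces at an edge, links and connectedness in \<open>T\<close>\<close>

lemma T_eq: "T = {{Inr F, Inl a, Inl b} | F a b. arc_on F a b}"
proof (intro equalityI subsetI)
  fix t assume "t \<in> T"
  then obtain F a b where F: "F \<in> Fs" "cyc_adj (bd F) a b" and t: "t = {Inr F, Inl a, Inl b}"
    unfolding T_tris_def by blast
  then have "t = {Inr F, Inl b, Inl a}" by (simp add: insert_commute)
  then show "t \<in> {{Inr F, Inl a, Inl b} | F a b. arc_on F a b}"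
    using cyc_adj_imp_arc_on[OF F] t by blast
next
  fix t :: "('a + 'f) set" assume "t \<in> {{Inr F, Inl a, Inl b} | F a b. arc_on F a b}"
  then obtain F a b where F: "F \<in> Fs" "cyc_adj (bd F) a b \<or> cyc_adj (bd F) b a"
    and t: "t = {Inr F, Inl a, Inl b}"
    unfolding arc_on_def by blast
  then have "t = {Inr F, Inl b, Inl a}" by (simp add: insert_commute)
  then show "t \<in> T" using F t unfolding T_tris_def by blast
qed

lemma arc_on_T: "arc_on F a b \<Longrightarrow> {Inr F, Inl a, Inl b} \<in> T"
  unfolding T_eq by blast

lemma T_face_iff:
  "{Inr F, Inl a, z} \<in> T \<longleftrightarrow> (\<exists>c. z = Inl c \<and> (arc_on F a c \<or> arc_on F c a))"
proof
  assume "{Inr F, Inl a, z} \<in> T"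
  then obtain G p q where G: "arc_on G p q" "{Inr F, Inl a, z} = {Inr G, Inl p, Inl q}"
    unfolding T_eq by blast
  have m: "Inr F \<in> {Inr G, Inl p, Inl q}" "Inl a \<in> {Inr G, Inl p, Inl q}"
    "Inl p \<in> {Inr F, Inl a, z}" "Inl q \<in> {Inr F, Inl a, z}"
    using G(2) by blast+
  have "p \<noteq> q" using arc_simple(1)[OF arc_on_arc[OF G(1)]] .
  then show "\<exists>c. z = Inl c \<and> (arc_on F a c \<or> arc_on F c a)" using m G(1) by auto
next
  assume "\<exists>c. z = Inl c \<and> (arc_on F a c \<or> arc_on F c a)"
  then obtain c where "z = Inl c" "arc_on F a c \<or> arc_on F c a" by blast
  moreover have "{Inr F, Inl a, Inl c} = {Inr F, Inl c, Inl a}" by (simp add: insert_commute)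
  ultimately show "{Inr F, Inl a, z} \<in> T" using arc_on_T[of F a c] arc_on_T[of F c a] by auto
qed

lemma T_arc_iff:
  "{Inl a, Inl b, z} \<in> T \<longleftrightarrow> (\<exists>F. z = Inr F \<and> (arc_on F a b \<or> arc_on F b a))"
proof
  assume "{Inl a, Inl b, z} \<in> T"
  then obtain G p q where G: "arc_on G p q" "{Inl a, Inl b, z} = {Inr G, Inl p, Inl q}"
    unfolding T_eq by blast
  have m: "Inl a \<in> {Inr G, Inl p, Inl q}" "Inl b \<in> {Inr G, Inl p, Inl q}"
    "Inr G \<in> {Inl a, Inl b, z}" "Inl p \<in> {Inl a, Inl b, z}" "Inl q \<in> {Inl a, Inl b, z}"
    using G(2) by blast+
  have "p \<noteq> q" using arc_simple(1)[OF arc_on_arc[OF G(1)]] .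
  then show "\<exists>F. z = Inr F \<and> (arc_on F a b \<or> arc_on F b a)" using m G(1) by auto
next
  assume "\<exists>F. z = Inr F \<and> (arc_on F a b \<or> arc_on F b a)"
  then obtain F where "z = Inr F" "arc_on F a b \<or> arc_on F b a" by blast
  moreover then have "{Inr F, Inl a, Inl b} \<in> T" using T_face_iff by blast
  ultimately show "{Inl a, Inl b, z} \<in> T" by (simp add: insert_commute)
qed

lemma T_edge_cases:
  assumes "e \<in> edges_of T"
  obtains (arc) a b where "e = {Inl a, Inl b}" "(a, b) \<in> A"
  | (spoke) F a where "e = {Inr F, Inl a}" "F \<in> Fs" "a \<in> set (bd F)"
proof -
  obtain F a b where F: "arc_on F a b" "e \<subseteq> {Inr F, Inl a, Inl b}" and c: "card e = 2"
    using assms unfolding edges_of_def T_eq by blast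
  obtain x y where xy: "e = {x, y}" "x \<noteq> y" using c by (auto simp: card_2_iff)
  have x: "x = Inr F \<or> x = Inl a \<or> x = Inl b" and y: "y = Inr F \<or> y = Inl a \<or> y = Inl b"
    using F(2) xy(1) by auto
  have "e = {Inl a, Inl b} \<or> e = {Inr F, Inl a} \<or> e = {Inr F, Inl b}"
    using x y xy by (elim disjE) (auto simp: insert_commute)
  then show ?thesis
    using that arc_on_arc[OF F(1)] arc_on_in_set[OF F(1)] arc_on_face[OF F(1)] by blast
qed

lemma arc_edge:
  assumes "(a, b) \<in> A"
  shows "{Inl a, Inl b} \<in> edges_of T"
proof -
  obtain F where "arc_on F a b" using arc_on_ex[OF assms] .
  from bexI[OF _ arc_on_T[OF this]] show ?thesis
    unfolding edges_of_def using arc_simple(1)[OF assms] by simp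
qed

lemma spoke_edge:
  assumes "F \<in> Fs" "a \<in> set (bd F)"
  shows "{Inr F, Inl a} \<in> edges_of T"
proof -
  obtain b where "arc_on F a b" using arc_on_at[OF assms] by blast
  from bexI[OF _ arc_on_T[OF this]] show ?thesis
    unfolding edges_of_def by simp
qed

text \<open>An arc lies in the two triangles that join it to the centres of its faces. A spoke from
  \<open>F\<close> to \<open>a\<close> lies in the triangles over the arc leaving \<open>a\<close>
  and over the arc entering \<open>a\<close> on the boundary of \<open>F\<close>.\<close>

lemma T_edge_two_faces:
  assumes "e \<in> edges_of T"
  shows "card {t \<in> T. e \<subseteq> t} = 2"
  using assms
proof (cases rule: T_edge_cases)
  case (arc a b)
  have "{t \<in> T. e \<subseteq> t} = (\<lambda>F. {Inr F, Inl a, Inl b}) ` {F. arc_on F a b}"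
  proof (intro equalityI subsetI)
    fix t assume "t \<in> {t \<in> T. e \<subseteq> t}"
    then obtain F p q where F: "arc_on F p q" "t = {Inr F, Inl p, Inl q}" "{Inl a, Inl b} \<subseteq> t"
      unfolding T_eq arc(1) by blast
    then have "p = a \<and> q = b \<or> p = b \<and> q = a" using arc_simple(1)[OF arc(2)] by auto
    moreover have "\<not> (p = b \<and> q = a)" using arc_simple(2)[OF arc(2)] arc_on_arc[OF F(1)] by blast
    ultimately show "t \<in> (\<lambda>F. {Inr F, Inl a, Inl b}) ` {F. arc_on F a b}" using F by blast
  next
    fix t :: "('a + 'f) set" assume "t \<in> (\<lambda>F. {Inr F, Inl a, Inl b}) ` {F. arc_on F a b}"
    then show "t \<in> {t \<in> T. e \<subseteq> t}" unfolding T_eq arc(1) by blast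
  qed
  moreover have "inj (\<lambda>F :: 'f. {Inr F, Inl a, Inl b})"
  proof (rule injI)
    fix F G :: 'f assume "{Inr F, Inl a, Inl b} = {Inr G, Inl a, Inl b}"
    then have "Inr F \<in> {Inr G, Inl a, Inl b}" by blast
    then show "F = G" by simp
  qed
  ultimately show ?thesis using arc_card_faces[OF arc(2)] by (simp add: card_image inj_on_subset)
next
  case (spoke F a)
  obtain b where b: "arc_on F a b" using arc_on_at[OF spoke(2,3)] by blast
  obtain c where c: "arc_on F c a" using arc_on_at[OF spoke(2,3)] by blast
  \<comment> \<open>If \<open>b\<close> and \<open>c\<close> were equal, the two arcs at
    \<open>a\<close> would be opposite to each other, which a simple digraph excludes.\<close>
  have ne: "b \<noteq> c" "b \<noteq> a" "c \<noteq> a" using arc_simple arc_on_arc[OF b] arc_on_arc[OF c] by blast+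
  have "{t \<in> T. e \<subseteq> t} = {{Inr F, Inl a, Inl b}, {Inr F, Inl c, Inl a}}"
  proof (intro equalityI subsetI)
    fix t assume "t \<in> {t \<in> T. e \<subseteq> t}"
    then obtain G p q where G: "arc_on G p q" "t = {Inr G, Inl p, Inl q}" "{Inr F, Inl a} \<subseteq> t"
      unfolding T_eq spoke(1) by blast
    then have "G = F" "p = a \<or> q = a" by auto
    then show "t \<in> {{Inr F, Inl a, Inl b}, {Inr F, Inl c, Inl a}}"
      using G arc_on_fun[OF b] arc_on_inj[OF c] by blast
  next
    fix t :: "('a + 'f) set" assume "t \<in> {{Inr F, Inl a, Inl b}, {Inr F, Inl c, Inl a}}"
    then show "t \<in> {t \<in> T. e \<subseteq> t}" using arc_on_T[OF b] arc_on_T[OF c] unfolding spoke(1) by auto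
  qed
  moreover have "Inl b \<notin> {Inr F, Inl c, Inl a}" using ne by simp
  then have "{Inr F, Inl a, Inl b} \<noteq> {Inr F, Inl c, Inl a}" by blast
  ultimately show ?thesis by simp
qed

text \<open>The link of a centre is the boundary cycle of its face. The link of an original vertex
  is its rotation with a centre inserted between neighbours that are consecutive on a face.\<close>

lemma T_link_connected:
  assumes "v \<in> T_verts V Fs" "{v, u} \<in> edges_of T" "{v, w} \<in> edges_of T"
  shows "(u, w) \<in> {(x, y). x \<noteq> y \<and> v \<notin> {x, y} \<and> {v, x, y} \<in> T}\<^sup>*"
    (is "_ \<in> ?L\<^sup>*")
proof (cases v)
  case (Inr F)
  have nbr: "F \<in> Fs \<and> (\<exists>a\<in>set (bd F). x = Inl a)" if "{v, x} \<in> edges_of T" for x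
    using that by (cases rule: T_edge_cases) (auto simp: Inr doubleton_eq_iff)
  obtain a b where a: "a \<in> set (bd F)" "u = Inl a" and b: "b \<in> set (bd F)" "w = Inl b" and F: "F \<in> Fs"
    using nbr assms(2,3) by blast
  have "(Inl a, Inl b) \<in> ?L\<^sup>*"
    using cyc_adj_connected[OF a(1) b(1)]
  proof (induction rule: rtrancl_induct)
    case (step x y)
    then have "arc_on F x y \<or> arc_on F y x" using cyc_adj_imp_arc_on[OF F] by simp
    moreover from this have "x \<noteq> y" using arc_simple(1) arc_on_arc by blast
    moreover have "{v, Inl x, Inl y} \<in> T" using calculation(1) unfolding Inr T_face_iff by blast
    ultimately have "(Inl x, Inl y) \<in> ?L" unfolding Inr by auto
    with step.IH show ?case by (rule rtrancl_into_rtrancl)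
  qed simp
  then show ?thesis using a b by simp
next
  case (Inl c)
  have c: "c \<in> V" using assms(1) unfolding Inl T_verts_def by auto
  have arc: "(Inl x, Inr F) \<in> ?L" "(Inr F, Inl x) \<in> ?L" if "arc_on F x c \<or> arc_on F c x" for F x
  proof -
    have "x \<noteq> c" using that arc_simple(1) arc_on_arc by blast
    moreover have "{v, Inl x, Inr F} \<in> T" using that unfolding Inl T_arc_iff by blast
    ultimately show "(Inl x, Inr F) \<in> ?L" "(Inr F, Inl x) \<in> ?L"
      unfolding Inl by (auto simp: insert_commute)
  qed
  \<comment> \<open>Every link vertex is joined to some original neighbour of \<open>c\<close>; the
    rotation at \<open>c\<close> then joins these neighbours.\<close>
  have near: "\<exists>a. {c, a} \<in> underlying A \<and> (x, Inl a) \<in> ?L\<^sup>* \<and> (Inl a, x) \<in> ?L\<^sup>*"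
    if "{v, x} \<in> edges_of T" for x
    using that
  proof (cases rule: T_edge_cases)
    case (arc a b)
    then obtain d where "x = Inl d" "{c, d} \<in> underlying A"
      unfolding Inl by (auto simp: doubleton_eq_iff underlying_iff)
    then show ?thesis by blast
  next
    case (spoke F a)
    then have x: "x = Inr F" "a = c" unfolding Inl by (auto simp: doubleton_eq_iff)
    obtain b where "arc_on F c b" using arc_on_at[OF spoke(2,3)] x by blast
    moreover then have "{c, b} \<in> underlying A" using arc_on_arc by (auto simp: underlying_iff)
    ultimately show ?thesis using arc[of F b] x by blast
  qed
  obtain a where a: "{c, a} \<in> underlying A" "(u, Inl a) \<in> ?L\<^sup>*" using near[OF assms(2)] by blast
  obtain b where b: "{c, b} \<in> underlying A" "(Inl b, w) \<in> ?L\<^sup>*" using near[OF assms(3)] by blast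
  have "(a, b) \<in> {(x, y). \<exists>F\<in>Fs. (cyc_adj (bd F) x c \<and> cyc_adj (bd F) c y) \<or>
      (cyc_adj (bd F) y c \<and> cyc_adj (bd F) c x)}\<^sup>*"
    using cell_embedding c a(1) b(1) unfolding closed_2cell_embedding_def by blast
  then have "(Inl a, Inl b) \<in> ?L\<^sup>*"
  proof (induction rule: rtrancl_induct)
    case (step x y)
    then obtain F where F: "F \<in> Fs" "(cyc_adj (bd F) x c \<and> cyc_adj (bd F) c y) \<or>
      (cyc_adj (bd F) y c \<and> cyc_adj (bd F) c x)" by blast
    then have "arc_on F x c \<or> arc_on F c x" "arc_on F y c \<or> arc_on F c y"
      using cyc_adj_imp_arc_on[OF F(1)] by blast+
    then have "(Inl x, Inr F) \<in> ?L" "(Inr F, Inl y) \<in> ?L" using arc by blast+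
    with step.IH show ?case by (meson rtrancl_into_rtrancl)
  qed simp
  then show ?thesis using a(2) b(2) by (meson rtrancl_trans)
qed

lemma bd_subset:
  assumes "F \<in> Fs"
  shows "set (bd F) \<subseteq> V"
proof
  fix a assume "a \<in> set (bd F)"
  then obtain b where "arc_on F a b" using arc_on_at(1)[OF assms] by blast
  then show "a \<in> V" using arc_simple(3) arc_on_arc by blast
qed

lemma bd_nonempty: "F \<in> Fs \<Longrightarrow> \<exists>a. a \<in> set (bd F)"
  using bd_length[of F] by (cases "bd F") auto

lemma T_connected:
  assumes "u \<in> T_verts V Fs" "w \<in> T_verts V Fs"
  shows "(u, w) \<in> {(x, y). {x, y} \<in> edges_of T}\<^sup>*" (is "_ \<in> ?R\<^sup>*")
proof -
  have near: "\<exists>a\<in>V. (x, Inl a) \<in> ?R\<^sup>* \<and> (Inl a, x) \<in> ?R\<^sup>*" if x: "x \<in> T_verts V Fs" for x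
  proof (cases x)
    case (Inl a)
    then show ?thesis using x unfolding T_verts_def by auto
  next
    case (Inr F)
    then have F: "F \<in> Fs" using x unfolding T_verts_def by auto
    then obtain a where a: "a \<in> set (bd F)" using bd_nonempty by blast
    have "(x, Inl a) \<in> ?R" "(Inl a, x) \<in> ?R"
      using spoke_edge[OF F a] Inr by (simp_all add: insert_commute)
    then show ?thesis using bd_subset[OF F] a by blast
  qed
  obtain a where a: "a \<in> V" "(u, Inl a) \<in> ?R\<^sup>*" using near[OF assms(1)] by blast
  obtain b where b: "b \<in> V" "(Inl b, w) \<in> ?R\<^sup>*" using near[OF assms(2)] by blast
  have "(a, b) \<in> {(x, y). {x, y} \<in> underlying A}\<^sup>*"
    using cell_embedding a(1) b(1) unfolding closed_2cell_embedding_def by blast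
  then have "(Inl a, Inl b) \<in> ?R\<^sup>*"
  proof (induction rule: rtrancl_induct)
    case (step x y)
    then have "(x, y) \<in> A \<or> (y, x) \<in> A" by (simp add: underlying_iff)
    then have "(Inl x, Inl y) \<in> ?R" using arc_edge[of x y] arc_edge[of y x] by (auto simp: insert_commute)
    with step.IH show ?case by (rule rtrancl_into_rtrancl)
  qed simp
  then show ?thesis using a(2) b(2) by (meson rtrancl_trans)
qed

lemma T_triangulation: "triangulation (T_verts V Fs) T"
  unfolding triangulation_def
proof (intro conjI ballI allI impI)
  have V: "finite V" "V \<noteq> {}" "finite Fs"
    using cell_embedding unfolding closed_2cell_embedding_def by blast+
  then show "finite (T_verts V Fs)" "T_verts V Fs \<noteq> {}" unfolding T_verts_def by auto
next
  fix t assume "t \<in> T"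
  then obtain F a b where F: "arc_on F a b" "t = {Inr F, Inl a, Inl b}" unfolding T_eq by blast
  show "t \<subseteq> T_verts V Fs"
    using F arc_on_face[OF F(1)] arc_simple[OF arc_on_arc[OF F(1)]] unfolding T_verts_def by auto
  show "card t = 3" using F(2) arc_simple[OF arc_on_arc[OF F(1)]] by simp
next
  fix v assume v: "v \<in> T_verts V Fs"
  show "\<exists>u. {v, u} \<in> edges_of T"
  proof (cases v)
    case (Inl c)
    then have "c \<in> V" using v unfolding T_verts_def by auto
    then obtain u where "{c, u} \<in> underlying A"
      using cell_embedding unfolding closed_2cell_embedding_def by blast
    then have "(c, u) \<in> A \<or> (u, c) \<in> A" by (simp add: underlying_iff)
    then have "{Inl c, Inl u} \<in> edges_of T"
      using arc_edge[of c u] arc_edge[of u c] by (auto simp: insert_commute)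
    then show ?thesis unfolding Inl by blast
  next
    case (Inr F)
    then have F: "F \<in> Fs" using v unfolding T_verts_def by auto
    then obtain a where "a \<in> set (bd F)" using bd_nonempty by blast
    from spoke_edge[OF F this] show ?thesis unfolding Inr by blast
  qed
qed (assumption | rule T_edge_two_faces T_link_connected T_connected)+

section \<open>The canonical z-orientation\<close>

sublocale closed_pseudosurface T
  by (rule triangulation_pseudosurface[OF T_triangulation])

text \<open>Three of the six flags of each triangle, the same ones that \<open>apex_flags\<close>
  finds in \<open>S\<close>; the centre may stand in any of the three positions.\<close>

definition forward_flags :: "(('a + 'f) \<times> ('a + 'f) \<times> ('a + 'f)) set" where
  "forward_flags = {f. \<exists>F a b. arc_on F a b \<and>
     f \<in> {(Inl a, Inl b, Inr F), (Inl a, Inr F, Inl b), (Inr F, Inl a, Inl b)}}"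

lemma forward_flags_simps:
  "(Inl a, Inl b, z) \<in> forward_flags \<longleftrightarrow> (\<exists>F. z = Inr F \<and> arc_on F a b)"
  "(Inl a, Inr F, z) \<in> forward_flags \<longleftrightarrow> (\<exists>b. z = Inl b \<and> arc_on F a b)"
  "(Inr F, y, z) \<in> forward_flags \<longleftrightarrow> (\<exists>a b. y = Inl a \<and> z = Inl b \<and> arc_on F a b)"
  unfolding forward_flags_def by auto

lemma arc_on_asym: "arc_on F a b \<Longrightarrow> \<not> arc_on G b a"
  using arc_on_arc arc_simple(2) by blast

lemma flag_cases:
  assumes "(x, y, z) \<in> flags"
  obtains F a b where "x = Inl a" "y = Inl b" "z = Inr F" "arc_on F a b \<or> arc_on F b a"
  | F a b where "x = Inl a" "y = Inr F" "z = Inl b" "arc_on F a b \<or> arc_on F b a"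
  | F a b where "x = Inr F" "y = Inl a" "z = Inl b" "arc_on F a b \<or> arc_on F b a"
proof -
  have T: "{x, y, z} \<in> T" using assms by simp
  show ?thesis
  proof (cases x)
    case x: (Inl a)
    show ?thesis
    proof (cases y)
      case (Inl b)
      then show ?thesis using T x that(1) unfolding x Inl T_arc_iff by blast
    next
      case (Inr F)
      then have "{Inr F, Inl a, z} \<in> T" using T x by (simp add: insert_commute)
      then show ?thesis using x Inr that(2) unfolding T_face_iff by blast
    qed
  next
    case x: (Inr F)
    show ?thesis
    proof (cases y)
      case (Inl a)
      then show ?thesis using T x that(3) unfolding x Inl T_face_iff by blast
    next
      case (Inr G)
      obtain H p q where H: "{x, y, z} = {Inr H, Inl p, Inl q}" using T unfolding T_eq by blast
      then have "x \<in> {Inr H, Inl p, Inl q}" "y \<in> {Inr H, Inl p, Inl q}" by blast+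
      then have "x = y" using x Inr by auto
      then show ?thesis using face_distinct[OF T] by simp
    qed
  qed
qed

lemma forward_flags_subset: "forward_flags \<subseteq> flags"
proof
  fix f assume "f \<in> forward_flags"
  then obtain F a b where ab: "arc_on F a b"
    and f: "f = (Inl a, Inl b, Inr F) \<or> f = (Inl a, Inr F, Inl b) \<or> f = (Inr F, Inl a, Inl b)"
    unfolding forward_flags_def by blast
  have "{Inl a, Inl b, Inr F} = {Inr F, Inl a, Inl b}" "{Inl a, Inr F, Inl b} = {Inr F, Inl a, Inl b}"
    by auto
  then show "f \<in> flags" using f arc_on_T[OF ab] by auto
qed

text \<open>Reversal exchanges the order of tail and head, and only one of the two orders is that of
  an arc.\<close>

lemma forward_flags_rev:
  assumes "f \<in> flags"
  shows "f \<in> forward_flags \<longleftrightarrow> rev_flag f \<notin> forward_flags"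
proof -
  obtain x y z where f: "f = (x, y, z)" by (cases f) auto
  with assms have "(x, y, z) \<in> flags" by simp
  then show ?thesis
    by (cases rule: flag_cases) (use arc_on_asym in \<open>auto simp: f forward_flags_simps\<close>)
qed

text \<open>With consecutive arcs from \<open>a\<close> to \<open>b\<close>, \<open>c\<close> and
  \<open>d\<close> on the boundary of \<open>F\<close>, a forward zigzag passes through the flags
  \<open>(a, b, F)\<close>, \<open>(b, F, c)\<close>, \<open>(F, c, d)\<close> and
  \<open>(c, d, G)\<close>, where \<open>G\<close> is the face across the last arc. Its edges are
  thus an arc, two spokes, an arc, and so on.\<close>

lemma nxt_forward:
  shows "arc_on F a b \<Longrightarrow> arc_on F b c \<Longrightarrow> nxt (Inl a, Inl b, Inr F) = (Inl b, Inr F, Inl c)"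
    and "arc_on F a b \<Longrightarrow> arc_on F b c \<Longrightarrow> nxt (Inl a, Inr F, Inl b) = (Inr F, Inl b, Inl c)"
    and "arc_on F a b \<Longrightarrow> \<exists>G. arc_on G a b \<and> nxt (Inr F, Inl a, Inl b) = (Inl a, Inl b, Inr G)"
proof -
  assume ab: "arc_on F a b"
  show "\<exists>G. arc_on G a b \<and> nxt (Inr F, Inl a, Inl b) = (Inl a, Inl b, Inr G)"
  proof -
    have "{Inl a, Inl b, Inr F} \<in> T" using T_arc_iff ab by blast
    from opp_in(2)[OF this] obtain G where G: "opp (Inl a) (Inl b) (Inr F) = Inr G" "arc_on G a b"
      using T_arc_iff arc_on_asym[OF ab] by blast
    then show ?thesis by simp
  qed
  assume bc: "arc_on F b c"
  have T: "{Inr F, Inl b, Inl a} \<in> T" "{Inr F, Inl b, Inl c} \<in> T" using ab bc T_face_iff by blast+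
  have "a \<noteq> c" using ab bc arc_on_asym by blast
  then have opp: "opp (Inr F) (Inl b) (Inl a) = Inl c" using opp_eq[OF T(1) _ T(2)] by simp
  then show "nxt (Inl a, Inr F, Inl b) = (Inr F, Inl b, Inl c)" by simp
  show "nxt (Inl a, Inl b, Inr F) = (Inl b, Inr F, Inl c)"
    using opp opp_swap[of "Inr F" "Inl b" "Inl a"] by simp
qed

lemma forward_flags_nxt:
  assumes "f \<in> forward_flags"
  shows "nxt f \<in> forward_flags"
proof -
  obtain F a b where ab: "arc_on F a b"
    and f: "f = (Inl a, Inl b, Inr F) \<or> f = (Inl a, Inr F, Inl b) \<or> f = (Inr F, Inl a, Inl b)"
    using assms unfolding forward_flags_def by blast
  obtain c where bc: "arc_on F b c" using arc_on_next[OF ab] by blast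
  obtain G where G: "arc_on G a b" "nxt (Inr F, Inl a, Inl b) = (Inl a, Inl b, Inr G)"
    using nxt_forward(3)[OF ab] by blast
  show ?thesis
    using f bc G(1) unfolding forward_flags_def
    by (elim disjE) (auto simp only: nxt_forward(1,2)[OF ab bc] G(2))
qed

definition canonical_orientation :: "(nat \<Rightarrow> ('a + 'f) set) set set" where
  "canonical_orientation = zz_class ` forward_flags"

lemma flags_of_canonical: "flags_of canonical_orientation = forward_flags"
  and canonical_z_orientation: "z_orientation T canonical_orientation"
  unfolding canonical_orientation_def
  by (rule z_orientation_of_flags[OF forward_flags_subset forward_flags_nxt forward_flags_rev]; assumption)+

lemma z_oriented: "z_orientation T \<tau> \<Longrightarrow> z_oriented_pseudosurface T \<tau>"
  by unfold_locales

text \<open>If \<open>(x, y, w)\<close> and \<open>(w, x, y)\<close> are both forward, then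
  \<open>w\<close> is a centre: with the centre at \<open>x\<close> or \<open>y\<close>, the two
  flags would contain the ends of the arc in opposite orders.\<close>

lemma canonical_arcs: "typeII_arcs T canonical_orientation = map_prod Inl Inl ` A"
proof -
  interpret O: z_oriented_pseudosurface T canonical_orientation
    by (rule z_oriented[OF canonical_z_orientation])
  have "(x, y) \<in> typeII_arcs T canonical_orientation \<longleftrightarrow> (x, y) \<in> map_prod Inl Inl ` A" for x y
  proof
    assume xy: "(x, y) \<in> typeII_arcs T canonical_orientation"
    then obtain w where T: "{x, y, w} \<in> T" using O.typeII_arcs_edge edges_ofE by blast
    then have S: "(x, y, w) \<in> forward_flags" "(w, x, y) \<in> forward_flags"
      using xy O.typeII_arcs_iff[OF T] unfolding flags_of_canonical by blast+
    have "(x, y, w) \<in> flags" using T by simp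
    then show "(x, y) \<in> map_prod Inl Inl ` A"
      by (cases rule: flag_cases)
        (use S arc_on_asym in \<open>auto simp: forward_flags_simps dest: arc_on_arc\<close>)
  next
    assume "(x, y) \<in> map_prod Inl Inl ` A"
    then obtain a b where ab: "x = Inl a" "y = Inl b" "(a, b) \<in> A" by auto
    obtain F where F: "arc_on F a b" using arc_on_ex[OF ab(3)] .
    have T: "{x, y, Inr F} \<in> T" unfolding ab T_arc_iff using F by blast
    show "(x, y) \<in> typeII_arcs T canonical_orientation"
      unfolding O.typeII_arcs_iff[OF T] flags_of_canonical
      using F ab by (auto simp: forward_flags_simps)
  qed
  then show ?thesis by auto
qed

section \<open>Types and homogeneity in the canonical orientation\<close>

lemma canonical_types:
  assumes "{x, y} \<in> edges_of T"
  shows "edge_typeI canonical_orientation {x, y} \<longleftrightarrow> (x, y) \<notin> map_prod Inl Inl ` A \<and> (y, x) \<notin> map_prod Inl Inl ` A"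
    and "edge_typeII canonical_orientation {x, y} \<longleftrightarrow> (x, y) \<in> map_prod Inl Inl ` A \<or> (y, x) \<in> map_prod Inl Inl ` A"
proof -
  interpret O: z_oriented_pseudosurface T canonical_orientation
    by (rule z_oriented[OF canonical_z_orientation])
  show "edge_typeI canonical_orientation {x, y} \<longleftrightarrow> (x, y) \<notin> map_prod Inl Inl ` A \<and> (y, x) \<notin> map_prod Inl Inl ` A"
    and "edge_typeII canonical_orientation {x, y} \<longleftrightarrow> (x, y) \<in> map_prod Inl Inl ` A \<or> (y, x) \<in> map_prod Inl Inl ` A"
    using O.not_typeI_iff[OF assms] O.typeII_iff_not_typeI[OF assms] unfolding canonical_arcs by blast+
qed

lemma canonical_edge_types:
  shows "(a, b) \<in> A \<Longrightarrow> edge_typeII canonical_orientation {Inl a, Inl b}"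
    and "F \<in> Fs \<Longrightarrow> a \<in> set (bd F) \<Longrightarrow> edge_typeI canonical_orientation {Inr F, Inl a}"
  using canonical_types(2)[OF arc_edge] canonical_types(1)[OF spoke_edge] by auto

lemma canonical_vertices: "typeII_vertices (T_verts V Fs) T canonical_orientation = Inl ` V"
proof (intro equalityI subsetI)
  fix v assume "v \<in> typeII_vertices (T_verts V Fs) T canonical_orientation"
  then obtain e where e: "e \<in> edges_of T" "v \<in> e" "\<not> edge_typeI canonical_orientation e"
    unfolding typeII_vertices_def by blast
  from e(1) show "v \<in> Inl ` V"
  proof (cases rule: T_edge_cases)
    case (arc a b)
    then show ?thesis using e(2) arc_simple[OF arc(2)] by auto
  next
    case (spoke F a)
    then show ?thesis using e(3) canonical_edge_types(2) by blast
  qed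
next
  fix v :: "'a + 'f" assume "v \<in> Inl ` V"
  then obtain c where c: "v = Inl c" "c \<in> V" by blast
  then obtain u where "{c, u} \<in> underlying A"
    using cell_embedding unfolding closed_2cell_embedding_def by blast
  then obtain a b where ab: "(a, b) \<in> A" "c \<in> {a, b}" by (auto simp: underlying_iff)
  have "\<not> edge_typeI canonical_orientation {Inl a, Inl b}"
    using edge_typeI_not_typeII canonical_edge_types(1)[OF ab(1)] by blast
  then show "v \<in> typeII_vertices (T_verts V Fs) T canonical_orientation"
    using arc_edge[OF ab(1)] c ab(2) unfolding typeII_vertices_def T_verts_def by auto
qed

lemma canonical_face_typeI:
  assumes "t \<in> T"
  shows "face_typeI T canonical_orientation t"
proof -
  obtain F a b where ab: "arc_on F a b" and t: "t = {Inr F, Inl a, Inl b}"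
    using assms unfolding T_eq by blast
  have F: "F \<in> Fs" "a \<in> set (bd F)" "b \<in> set (bd F)"
    using arc_on_face[OF ab] arc_on_in_set[OF ab] by auto
  note A = arc_on_arc[OF ab]
  have ne: "a \<noteq> b" using arc_simple(1)[OF A] .
  let ?e = "{Inl a, Inl b}" and ?f = "{Inr F, Inl a}" and ?g = "{Inr F, Inl b}"
  have sub: "e = ?e \<or> e = ?f \<or> e = ?g" if e: "e \<in> edges_of T" "e \<subseteq> t" for e
  proof -
    have "card e = 2" using e(1) unfolding edges_of_def by simp
    then obtain x y where xy: "e = {x, y}" "x \<noteq> y" by (auto simp: card_2_iff)
    then have "x = Inr F \<or> x = Inl a \<or> x = Inl b" "y = Inr F \<or> y = Inl a \<or> y = Inl b"
      using e(2) t by auto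
    then show ?thesis using xy by (elim disjE) (auto simp: insert_commute)
  qed
  have edge: "?e \<in> edges_of T" "?f \<in> edges_of T" "?g \<in> edges_of T"
    using arc_edge[OF A] spoke_edge F by blast+
  have II: "edge_typeII canonical_orientation ?e" using canonical_edge_types(1)[OF A] .
  have I: "edge_typeI canonical_orientation ?f" "edge_typeI canonical_orientation ?g"
    using canonical_edge_types(2) F by blast+
  have in_t: "?e \<subseteq> t" "?f \<subseteq> t" "?g \<subseteq> t" using t by auto
  have not_I: "\<not> edge_typeI canonical_orientation ?e"
    using II edge_typeI_not_typeII by blast
  have not_II: "\<not> edge_typeII canonical_orientation ?f" "\<not> edge_typeII canonical_orientation ?g"
    using I[THEN edge_typeI_not_typeII] .
  have "{e \<in> edges_of T. e \<subseteq> t \<and> edge_typeI canonical_orientation e} = {?f, ?g}"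
  proof (intro equalityI subsetI)
    fix e assume "e \<in> {e \<in> edges_of T. e \<subseteq> t \<and> edge_typeI canonical_orientation e}"
    then have e: "e \<in> edges_of T" "e \<subseteq> t" "edge_typeI canonical_orientation e" by simp_all
    from sub[OF e(1,2)] show "e \<in> {?f, ?g}"
      using e(3) not_I by (elim disjE) simp_all
  next
    fix e assume "e \<in> {?f, ?g}"
    then have "e = ?f \<or> e = ?g" by simp
    then show "e \<in> {e \<in> edges_of T. e \<subseteq> t \<and> edge_typeI canonical_orientation e}"
      by (elim disjE) (simp_all only: mem_Collect_eq edge I in_t simp_thms)
  qed
  moreover have "?f \<noteq> ?g" using ne by (auto simp: doubleton_eq_iff)
  moreover have "{e \<in> edges_of T. e \<subseteq> t \<and> edge_typeII canonical_orientation e} = {?e}"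
  proof (intro equalityI subsetI)
    fix e assume "e \<in> {e \<in> edges_of T. e \<subseteq> t \<and> edge_typeII canonical_orientation e}"
    then have e: "e \<in> edges_of T" "e \<subseteq> t" "edge_typeII canonical_orientation e" by simp_all
    from sub[OF e(1,2)] show "e \<in> {?e}"
      using e(3) not_II by (elim disjE) simp_all
  next
    fix e :: "('a + 'f) set" assume "e \<in> {?e}"
    then have "e = ?e" by simp
    then show "e \<in> {e \<in> edges_of T. e \<subseteq> t \<and> edge_typeII canonical_orientation e}"
      by (simp only: mem_Collect_eq edge II in_t simp_thms)
  qed
  ultimately show ?thesis unfolding face_typeI_def by simp
qed

text \<open>Three steps lead from an arc over two spokes of the same face to the arc two places
  further on its boundary, and into the face across that arc.\<close>

lemma forward_period:
  assumes "arc_on F a b"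
  shows "\<exists>G c d. arc_on G c d \<and> (nxt ^^ (3 * i)) (Inl a, Inl b, Inr F) = (Inl c, Inl d, Inr G)"
proof (induction i)
  case 0
  then show ?case using assms by auto
next
  case (Suc i)
  then obtain G c d where G: "arc_on G c d" "(nxt ^^ (3 * i)) (Inl a, Inl b, Inr F) = (Inl c, Inl d, Inr G)"
    by blast
  obtain e where e: "arc_on G d e" using arc_on_next[OF G(1)] by blast
  obtain h where h: "arc_on G e h" using arc_on_next[OF e] by blast
  obtain H where H: "arc_on H e h" "nxt (Inr G, Inl e, Inl h) = (Inl e, Inl h, Inr H)"
    using nxt_forward(3)[OF h] by blast
  have "3 * Suc i = Suc (Suc (Suc (3 * i)))" by simp
  then have "(nxt ^^ (3 * Suc i)) (Inl a, Inl b, Inr F) = nxt (nxt (nxt (Inl c, Inl d, Inr G)))"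
    by (simp only: funpow.simps(2) o_apply G(2))
  also have "\<dots> = (Inl e, Inl h, Inr H)"
    by (simp only: nxt_forward(1)[OF G(1) e] nxt_forward(2)[OF e h] H(2))
  finally show ?case using H(1) by blast
qed

lemma canonical_homogeneous:
  assumes "Z \<in> canonical_orientation"
  shows "homogeneous canonical_orientation Z"
proof -
  obtain f where f: "f \<in> forward_flags" "Z = zz_class f"
    using assms unfolding canonical_orientation_def by blast
  then obtain F a b where ab: "arc_on F a b"
    and cases: "f = (Inl a, Inl b, Inr F) \<or> f = (Inl a, Inr F, Inl b) \<or> f = (Inr F, Inl a, Inl b)"
    unfolding forward_flags_def by blast
  have fl: "f \<in> flags" using f forward_flags_subset by blast
  \<comment> \<open>The pattern has to begin with a type II edge. According to the position of the
    centre in \<open>f\<close>, this takes 0, 2 or 1 steps.\<close>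
  have "\<exists>k G c d. arc_on G c d \<and> (nxt ^^ k) f = (Inl c, Inl d, Inr G)"
    using cases
  proof (elim disjE)
    assume "f = (Inl a, Inl b, Inr F)"
    then show ?thesis using ab by (intro exI[of _ 0]) auto
  next
    assume fe: "f = (Inl a, Inr F, Inl b)"
    obtain c where c: "arc_on F b c" using arc_on_next[OF ab] by blast
    obtain G where G: "arc_on G b c" "nxt (Inr F, Inl b, Inl c) = (Inl b, Inl c, Inr G)"
      using nxt_forward(3)[OF c] by blast
    have "(nxt ^^ Suc (Suc 0)) f = (Inl b, Inl c, Inr G)"
      by (simp only: fe funpow.simps o_apply id_apply nxt_forward(2)[OF ab c] G(2))
    then show ?thesis using G(1) by blast
  next
    assume fe: "f = (Inr F, Inl a, Inl b)"
    obtain G where G: "arc_on G a b" "nxt f = (Inl a, Inl b, Inr G)"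
      using nxt_forward(3)[OF ab] fe by blast
    have "(nxt ^^ Suc 0) f = (Inl a, Inl b, Inr G)"
      by (simp only: funpow.simps o_apply id_apply G(2))
    then show ?thesis using G(1) by blast
  qed
  then obtain k G c d where G: "arc_on G c d" "(nxt ^^ k) f = (Inl c, Inl d, Inr G)" by blast
  define g where "g = (nxt ^^ k) f"
  have "zz g \<in> Z"
    using zz_in_zz_class[of g] zz_class_funpow[OF fl, of k] f(2) unfolding g_def by simp
  moreover have "edge_typeII canonical_orientation (zz g (3 * i)) \<and>
      edge_typeI canonical_orientation (zz g (3 * i + 1)) \<and> edge_typeI canonical_orientation (zz g (3 * i + 2))" for i
  proof -
    obtain H p q where H: "arc_on H p q" "(nxt ^^ (3 * i)) g = (Inl p, Inl q, Inr H)"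
      using forward_period[OF G(1), of i] G(2) unfolding g_def by auto
    obtain r where r: "arc_on H q r" using arc_on_next[OF H(1)] by blast
    obtain u where u: "arc_on H r u" using arc_on_next[OF r] by blast
    have "3 * i + 1 = Suc (3 * i)" "3 * i + 2 = Suc (Suc (3 * i))" by simp_all
    then have "zz g (3 * i) = {Inl p, Inl q}" "zz g (3 * i + 1) = {Inl q, Inr H}"
      "zz g (3 * i + 2) = {Inr H, Inl r}"
      unfolding zz_def
      by (simp_all only: funpow.simps o_apply H(2) nxt_forward(1)[OF H(1) r]
          nxt_forward(2)[OF r u] flag_edge.simps)
    moreover have "{Inl q, Inr H} = {Inr H, Inl q}" by (rule insert_commute)
    moreover have "edge_typeI canonical_orientation {Inr H, Inl q}"
      "edge_typeI canonical_orientation {Inr H, Inl r}"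
      using canonical_edge_types(2) arc_on_face[OF r] arc_on_in_set[OF r] by blast+
    ultimately show ?thesis
      using canonical_edge_types(1)[OF arc_on_arc[OF H(1)]] by simp
  qed
  ultimately show ?thesis unfolding homogeneous_def by blast
qed

text \<open>The prescribed arcs force the flags with the centre in first or last position. A flag
  with the centre in the middle is the successor of one with the centre last, taken at the preceding
  arc. So all forward flags belong to \<open>\<tau>\<close>, and since both sets contain exactly one
  of each flag and its reversal, they are equal.\<close>

lemma canonical_unique:
  assumes \<tau>: "z_orientation T \<tau>" and arcs: "typeII_arcs T \<tau> = map_prod Inl Inl ` A"
  shows "\<tau> = canonical_orientation"
proof -
  interpret O: z_oriented_pseudosurface T \<tau> by (rule z_oriented[OF \<tau>])
  have ends: "(Inl a, Inl b, Inr F) \<in> flags_of \<tau>" "(Inr F, Inl a, Inl b) \<in> flags_of \<tau>" if "arc_on F a b" for F a b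
  proof -
    have T: "{Inl a, Inl b, Inr F} \<in> T" using that T_arc_iff by blast
    have "(Inl a, Inl b) \<in> typeII_arcs T \<tau>" unfolding arcs using arc_on_arc[OF that] by auto
    then show "(Inl a, Inl b, Inr F) \<in> flags_of \<tau>" "(Inr F, Inl a, Inl b) \<in> flags_of \<tau>"
      using O.typeII_arcs_iff[OF T] by blast+
  qed
  have mid: "(Inl a, Inr F, Inl b) \<in> flags_of \<tau>" if ab: "arc_on F a b" for F a b
  proof -
    obtain c where ca: "arc_on F c a" using arc_on_prev[OF ab] by blast
    have "(Inl c, Inl a, Inr F) \<in> flags" using ca T_arc_iff by simp
    from nxt_flags_of[OF this] show ?thesis
      using ends(1)[OF ca] unfolding nxt_forward(1)[OF ca ab] by blast
  qed
  have sub: "forward_flags \<subseteq> flags_of \<tau>"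
    unfolding forward_flags_def using ends mid by blast
  have or: "\<tau> = zz_class ` flags_of \<tau>" and rev: "\<forall>f\<in>flags. f \<in> flags_of \<tau> \<longleftrightarrow> rev_flag f \<notin> flags_of \<tau>"
    using \<tau> unfolding z_orientation_iff_flags by blast+
  have "flags_of \<tau> \<subseteq> forward_flags"
  proof
    fix f assume f: "f \<in> flags_of \<tau>"
    then have "f \<in> flags" unfolding flags_of_def by simp
    then show "f \<in> forward_flags" using f sub rev forward_flags_rev by blast
  qed
  with sub have "flags_of \<tau> = forward_flags" by blast
  then show ?thesis using or unfolding canonical_orientation_def by simp
qed

lemma canonical_orientation_ex1:
  "\<exists>!\<tau>. z_orientation T \<tau> \<and> (\<forall>t\<in>T. face_typeI T \<tau> t) \<and> (\<forall>Z\<in>\<tau>. homogeneous \<tau> Z) \<and>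
     typeII_vertices (T_verts V Fs) T \<tau> = Inl ` V \<and> typeII_arcs T \<tau> = map_prod Inl Inl ` A"
proof (rule ex1I[of _ canonical_orientation])
  show "z_orientation T canonical_orientation \<and> (\<forall>t\<in>T. face_typeI T canonical_orientation t) \<and>
      (\<forall>Z\<in>canonical_orientation. homogeneous canonical_orientation Z) \<and>
      typeII_vertices (T_verts V Fs) T canonical_orientation = Inl ` V \<and>
      typeII_arcs T canonical_orientation = map_prod Inl Inl ` A"
    by (intro conjI ballI canonical_z_orientation canonical_face_typeI canonical_homogeneous
        canonical_vertices canonical_arcs)
qed (elim conjE, rule canonical_unique)

end

theorem theorem1:
  shows "(\<forall>(V::'v set) T \<tau>.
            triangulation V T \<and> z_orientation T \<tau> \<and> (\<forall>t\<in>T. face_typeI T \<tau> t) \<and>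
            (\<forall>Z\<in>\<tau>. homogeneous \<tau> Z) \<longrightarrow>
            (\<exists>(Fs::'v set) bd h.
               eulerian_dir_embedding (typeII_vertices V T \<tau>) (typeII_arcs T \<tau>) Fs bd \<and>
               bij_betw h (T_verts (typeII_vertices V T \<tau>) Fs) V \<and>
               (\<forall>v\<in>typeII_vertices V T \<tau>. h (Inl v) = v) \<and>
               T = (\<lambda>t. h ` t) ` T_tris Fs bd))
       \<and> (\<forall>(V::'a set) A (Fs::'f set) bd.
            eulerian_dir_embedding V A Fs bd \<longrightarrow>
            triangulation (T_verts V Fs) (T_tris Fs bd) \<and>
            (\<exists>!\<tau>. z_orientation (T_tris Fs bd) \<tau> \<and>
                   (\<forall>t\<in>T_tris Fs bd. face_typeI (T_tris Fs bd) \<tau> t) \<and>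
                   (\<forall>Z\<in>\<tau>. homogeneous \<tau> Z) \<and>
                   typeII_vertices (T_verts V Fs) (T_tris Fs bd) \<tau> = Inl ` V \<and>
                   typeII_arcs (T_tris Fs bd) \<tau> = map_prod Inl Inl ` A))"
proof (intro conjI allI impI; (elim conjE)?)
  fix V :: "'v set" and T \<tau>
  assume *: "triangulation V T" "z_orientation T \<tau>" "\<forall>t\<in>T. face_typeI T \<tau> t" "\<forall>Z\<in>\<tau>. homogeneous \<tau> Z"
  interpret closed_pseudosurface T by (rule triangulation_pseudosurface[OF *(1)])
  interpret homogeneous_triangulation T \<tau> V by unfold_locales (use * in auto)
  show "\<exists>(Fs::'v set) bd h.
      eulerian_dir_embedding (typeII_vertices V T \<tau>) (typeII_arcs T \<tau>) Fs bd \<and>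
      bij_betw h (T_verts (typeII_vertices V T \<tau>) Fs) V \<and>
      (\<forall>v\<in>typeII_vertices V T \<tau>. h (Inl v) = v) \<and> T = (\<lambda>t. h ` t) ` T_tris Fs bd"
    by (rule typeII_reconstruction)
next
  fix V :: "'a set" and A and Fs :: "'f set" and bd
  assume "eulerian_dir_embedding V A Fs bd"
  then interpret directed_embedding V A Fs bd by unfold_locales
  show "triangulation (T_verts V Fs) (T_tris Fs bd)" by (rule T_triangulation)
  show "\<exists>!\<tau>. z_orientation (T_tris Fs bd) \<tau> \<and>
      (\<forall>t\<in>T_tris Fs bd. face_typeI (T_tris Fs bd) \<tau> t) \<and> (\<forall>Z\<in>\<tau>. homogeneous \<tau> Z) \<and>
      typeII_vertices (T_verts V Fs) (T_tris Fs bd) \<tau> = Inl ` V \<and>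
      typeII_arcs (T_tris Fs bd) \<tau> = map_prod Inl Inl ` A"
    by (rule canonical_orientation_ex1)
qed

end
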